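(* Let $\Omega$ be either the whole plane $\mathbb{R}^2$ or an exterior domain $\Omega=\{x\in\mathbb{R}^2 : |x|>r_0\}$ with some $r_0>0$. Let $a_{ij}$ ($i,j=1,2$), $\mathbf{b}=(b_1,b_2)$ and $c$ be real-valued coefficients on $\Omega$ satisfying the following. (1) $a_{ij}\in C^1(\Omega)$, $a_{ij}=a_{ji}$ for $i,j=1,2$, and there is $\lambda>0$ with $\sum_{i,j=1}^2 a_{ij}(x)\xi_i\xi_j\ge\lambda|\xi|^2$ for all $\xi\in\mathbb{R}^2$, $x\in\Omega$; moreover, for some $\alpha\in[0,2]$, $|a_{ij}(x)|=O(|x|^{\alpha})$ and $|\partial_i a_{ij}(x)|=O(|x|^{\alpha-1})$ as $|x|\to\infty$ for $i,j=1,2$. (2) $\mathbf{b}\in C^1(\Omega)$ and, for some $\beta\le 1$, $\mathbf{b}(x)=O(|x|^{\beta})$ as $|x|\to\infty$. (3) $c$ is measurable and nonnegative. (4) At least one of the following holds: $\operatorname{div}\mathbf{b}(x)\le 2c(x)$ in $\Omega$; or $|\operatorname{div}\mathbf{b}(x)|=O(|x|^{\beta-1})$ as $|x|\to\infty$. Suppose that $u\in C^2(\Omega)$ satisfies $$-\sum_{i,j=1}^2\partial_i\big(a_{ij}(x)\partial_j u\big)+\mathbf{b}(x)\cdot\nabla u+c(x)u=0\quad\text{in }\Omega$$ and that $u\in L^q(\Omega)$ for some $q\in[2,\infty)$. Then $$\sup_{0\le\theta\le 2\pi}|u(r,\theta)|=o\Big(r^{-\frac1q\left(1+\frac{\gamma}{2}\right)}\Big)\quad\text{as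 } r\to\infty,$$ where $\gamma=\min\{1-\beta,\,2-\alpha\}$.
   Context: $(r,\theta)$ denotes polar coordinates in $\mathbb{R}^2$, and $u(r,\theta)$ is the value of $u$ at $x=(r\cos\theta,r\sin\theta)$. Functions are real-valued. $\partial_i=\partial/\partial x_i$ and $\operatorname{div}\mathbf{b}=\partial_1 b_1+\partial_2 b_2$. *)

theory Defs
  imports "HOL-Analysis.Analysis" "HOL-Library.Landau_Symbols"
begin

text \<open>
  Functions on an open set \<open>\<Omega>\<close> are represented by total functions whose values outside \<open>\<Omega>\<close>
  are irrelevant; the operators below are local, so they are meaningful at points of \<open>\<Omega>\<close>
  at which the function is differentiable.
\<close>

definition partial_deriv :: "'n::finite \<Rightarrow> (real^'n \<Rightarrow> real) \<Rightarrow> real^'n \<Rightarrow> real"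
  where "partial_deriv i f x = frechet_derivative f (at x) (axis i 1)"

definition grad :: "(real^'n::finite \<Rightarrow> real) \<Rightarrow> real^'n \<Rightarrow> real^'n"
  where "grad f x = (\<chi> i. partial_deriv i f x)"

definition divergence :: "(real^'n::finite \<Rightarrow> real^'n) \<Rightarrow> real^'n \<Rightarrow> real"
  where "divergence b x = (\<Sum>i\<in>UNIV. partial_deriv i (\<lambda>y. b y $ i) x)"

text \<open>The next two definitions are intended for open \<open>\<Omega>\<close> only.\<close>

definition C1_on :: "(real^'n::finite) set \<Rightarrow> (real^'n \<Rightarrow> real) \<Rightarrow> bool"
  where "C1_on \<Omega> f \<longleftrightarrow>
    (\<forall>x\<in>\<Omega>. f differentiable (at x)) \<and> (\<forall>i. continuous_on \<Omega> (partial_deriv i f))"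

definition C2_on :: "(real^'n::finite) set \<Rightarrow> (real^'n \<Rightarrow> real) \<Rightarrow> bool"
  where "C2_on \<Omega> f \<longleftrightarrow> C1_on \<Omega> f \<and> (\<forall>i. C1_on \<Omega> (partial_deriv i f))"

definition in_Lq :: "real \<Rightarrow> (real^'n::finite) set \<Rightarrow> (real^'n \<Rightarrow> real) \<Rightarrow> bool"
  where "in_Lq q \<Omega> f \<longleftrightarrow>
    f \<in> borel_measurable (lebesgue_on \<Omega>) \<and>
    integrable (lebesgue_on \<Omega>) (\<lambda>x. \<bar>f x\<bar> powr q)"

definition plane_or_exterior :: "(real^2) set \<Rightarrow> bool"
  where "plane_or_exterior \<Omega> \<longleftrightarrow> \<Omega> = UNIV \<or> (\<exists>r0>0. \<Omega> = {x. norm x > r0})"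

definition polar_point :: "real \<Rightarrow> real \<Rightarrow> real^2"
  where "polar_point r \<theta> = vector [r * cos \<theta>, r * sin \<theta>]"

end

theory Submission
  imports Defs
begin

text \<open>
  The growth conditions make \<open>u\<close> small on the boundary of a well chosen square in each dyadic shell,
  and the maximum principle carries this smallness to all circles between two such squares.
  Write \<open>S\<^sub>R\<close> and \<open>T\<^sub>R\<close> for the shells \<open>1/2 \<le> |x|\<^sup>2/R\<^sup>2 \<le> 9\<close> and \<open>1 \<le> |x|\<^sup>2/R\<^sup>2 \<le> 8\<close>.

  Energy estimate (\<open>caccioppoli\<close>).  Test the equation with \<open>\<eta> |u|\<^bsup>q-2\<^esup> u\<close>, where the cutoff \<open>\<eta>\<close>
  lives on \<open>S\<^sub>R\<close>.  Ellipticity controls \<open>|u|\<^bsup>q-2\<^esup> |\<nabla>u|\<^sup>2\<close>; the terms in which \<open>\<eta>\<close> is differentiated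
  are at most \<open>|u|\<^sup>q\<close> times \<open>|a|/R\<^sup>2 + |b|/R\<close>, and \<open>div b\<close> either is absorbed
  by \<open>q c \<ge> 2 c\<close> or is \<open>O(R\<^bsup>\<beta>-1\<^esup>)\<close>.  All of this is \<open>O(R\<^bsup>-\<gamma>\<^esup>) |u|\<^sup>q\<close>,
  so the integral of \<open>|u|\<^bsup>q-2\<^esup> |\<nabla>u|\<^sup>2\<close> over \<open>T\<^sub>R\<close> is at most \<open>C R\<^bsup>-\<gamma>\<^esup>\<close> times the integral
  \<open>I(R)\<close> of \<open>|u|\<^sup>q\<close> over \<open>S\<^sub>R\<close>.

  Good squares (\<open>exists_square_power_bound\<close>).  The gradient of \<open>|u|\<^sup>q\<close> has size \<open>q |u|\<^bsup>q-1\<^esup> |\<nabla>u|\<close>,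
  which is at most \<open>q (\<mu> |u|\<^sup>q + |u|\<^bsup>q-2\<^esup> |\<nabla>u|\<^sup>2 / \<mu>)\<close>; for \<open>\<mu> = R\<^bsup>-\<gamma>/2\<^esup>\<close> its integral over \<open>T\<^sub>R\<close> is
  \<open>O(R\<^bsup>-\<gamma>/2\<^esup>) I(R)\<close>.  Averaging over the boundaries of the squares with half side \<open>s\<close> between \<open>R\<close> and
  \<open>2 R\<close> gains another factor \<open>1/R\<close>: on one of these boundaries the line integrals of
  \<open>|u|\<^sup>q / R\<close> and of the gradient of \<open>|u|\<^sup>q\<close> are at most \<open>C R\<^bsup>-1-\<gamma>/2\<^esup> I(R)\<close>.  In one dimension a
  function is bounded by its mean plus its variation, hence \<open>|u|\<^sup>q\<close> itself satisfies this bound on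
  that boundary.  Since \<open>u\<close> is in \<open>L\<^sup>q\<close>, the factor \<open>I(R)\<close> tends to 0.

  Circles (\<open>abs_le_of_frontier\<close>).  The circle of radius \<open>r\<close> lies between the good squares found for
  \<open>R = r/4\<close> and \<open>R = r\<close>, and \<open>c \<ge> 0\<close> allows the weak maximum principle for \<open>u\<close> and \<open>-u\<close>.
  Squares take the place of circles in the averaging step because Fubini's theorem then
  applies in Cartesian coordinates.
\<close>

section \<open>Partial derivatives and \<open>C\<^sup>1\<close> functions\<close>

lemma partial_deriv_eq:
  assumes "(f has_derivative f') (at x)"
  shows "partial_deriv i f x = f' (axis i 1)"
  unfolding partial_deriv_def using frechet_derivative_at[OF assms] by simp

lemma has_derivative_partial_deriv:
  fixes f :: "real^'n::finite \<Rightarrow> real"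
  assumes "f differentiable (at x)"
  shows "(f has_derivative (\<lambda>h. \<Sum>i\<in>UNIV. partial_deriv i f x * h $ i)) (at x)"
proof -
  let ?D = "frechet_derivative f (at x)"
  have D: "(f has_derivative ?D) (at x)"
    using assms frechet_derivative_works by blast
  then have "linear ?D"
    by (rule has_derivative_linear)
  have "?D h = (\<Sum>i\<in>UNIV. partial_deriv i f x * h $ i)" for h
  proof -
    have "?D h = ?D (\<Sum>i\<in>UNIV. h $ i *\<^sub>R axis i 1)"
      using basis_expansion[of h] by (simp add: scalar_mult_eq_scaleR)
    also have "\<dots> = (\<Sum>i\<in>UNIV. h $ i *\<^sub>R ?D (axis i 1))"
      using \<open>linear ?D\<close> by (simp add: linear_sum linear_cmul)
    finally show ?thesis
      by (simp add: partial_deriv_def mult.commute)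
  qed
  then have "?D = (\<lambda>h. \<Sum>i\<in>UNIV. partial_deriv i f x * h $ i)" by (rule ext)
  with D show ?thesis by simp
qed

lemma partial_deriv_mult:
  assumes "f differentiable (at x)" "g differentiable (at x)"
  shows "partial_deriv i (\<lambda>y. f y * g y) x = f x * partial_deriv i g x + partial_deriv i f x * g x"
  using assms frechet_derivative_works[of f "at x"] frechet_derivative_works[of g "at x"]
  by (subst partial_deriv_eq[OF has_derivative_mult]) (auto simp: partial_deriv_def)

lemma partial_deriv_diff:
  assumes "f differentiable (at x)" "g differentiable (at x)"
  shows "partial_deriv i (\<lambda>y. f y - g y) x = partial_deriv i f x - partial_deriv i g x"
  using assms frechet_derivative_works[of f "at x"] frechet_derivative_works[of g "at x"]
  by (subst partial_deriv_eq[OF has_derivative_diff]) (auto simp: partial_deriv_def)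

lemma partial_deriv_sum:
  assumes "\<And>j. j \<in> J \<Longrightarrow> f j differentiable (at x)"
  shows "partial_deriv i (\<lambda>y. \<Sum>j\<in>J. f j y) x = (\<Sum>j\<in>J. partial_deriv i (f j) x)"
proof -
  have "((\<lambda>y. \<Sum>j\<in>J. f j y) has_derivative (\<lambda>h. \<Sum>j\<in>J. frechet_derivative (f j) (at x) h)) (at x)"
    using assms frechet_derivative_works by (intro has_derivative_sum) blast
  then show ?thesis
    by (subst partial_deriv_eq) (auto simp: partial_deriv_def)
qed

lemma has_derivative_compose_real:
  assumes "f differentiable (at x)" "(g has_real_derivative g') (at (f x))"
  shows "((\<lambda>y. g (f y)) has_derivative (\<lambda>h. g' * frechet_derivative f (at x) h)) (at x)"
  using has_derivative_compose[of f "frechet_derivative f (at x)" x UNIV g "\<lambda>h. g' * h"] assms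
    frechet_derivative_works[of f "at x"]
  by (auto simp: has_field_derivative_def)

lemma partial_deriv_compose:
  assumes "f differentiable (at x)" "(g has_real_derivative g') (at (f x))"
  shows "partial_deriv i (\<lambda>y. g (f y)) x = g' * partial_deriv i f x"
  using partial_deriv_eq[OF has_derivative_compose_real[OF assms]]
  by (simp add: partial_deriv_def)

lemma C1_onD:
  assumes "C1_on \<Omega> f"
  shows "x \<in> \<Omega> \<Longrightarrow> f differentiable (at x)" "continuous_on \<Omega> (partial_deriv i f)"
    "continuous_on \<Omega> f"
proof -
  show "x \<in> \<Omega> \<Longrightarrow> f differentiable (at x)" "continuous_on \<Omega> (partial_deriv i f)"
    using assms by (auto simp: C1_on_def)
  show "continuous_on \<Omega> f"
    using assms by (intro continuous_at_imp_continuous_on ballI differentiable_imp_continuous_within)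
      (auto simp: C1_on_def)
qed

lemma C1_on_subset: "C1_on T f \<Longrightarrow> S \<subseteq> T \<Longrightarrow> C1_on S f"
  by (auto simp: C1_on_def intro: continuous_on_subset)

lemma C1_on_mult:
  assumes "C1_on \<Omega> f" "C1_on \<Omega> g"
  shows "C1_on \<Omega> (\<lambda>x. f x * g x)"
  unfolding C1_on_def
proof (intro conjI ballI allI)
  show "(\<lambda>x. f x * g x) differentiable at x" if "x \<in> \<Omega>" for x
    using C1_onD(1)[OF assms(1) that] C1_onD(1)[OF assms(2) that] by (rule differentiable_mult)
  show "continuous_on \<Omega> (partial_deriv i (\<lambda>x. f x * g x))" for i
    by (subst continuous_on_cong[OF refl partial_deriv_mult])
      (auto intro!: continuous_intros C1_onD[OF assms(1)] C1_onD[OF assms(2)])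
qed

lemma C1_on_diff:
  assumes "C1_on \<Omega> f" "C1_on \<Omega> g"
  shows "C1_on \<Omega> (\<lambda>x. f x - g x)"
  unfolding C1_on_def
proof (intro conjI ballI allI)
  show "(\<lambda>x. f x - g x) differentiable at x" if "x \<in> \<Omega>" for x
    using C1_onD(1)[OF assms(1) that] C1_onD(1)[OF assms(2) that] by (rule differentiable_diff)
  show "continuous_on \<Omega> (partial_deriv i (\<lambda>x. f x - g x))" for i
    by (subst continuous_on_cong[OF refl partial_deriv_diff])
      (auto intro!: continuous_intros C1_onD[OF assms(1)] C1_onD[OF assms(2)])
qed

lemma C1_on_sum:
  assumes "\<And>j. j \<in> J \<Longrightarrow> C1_on \<Omega> (f j)" "finite J"
  shows "C1_on \<Omega> (\<lambda>x. \<Sum>j\<in>J. f j x)"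
  unfolding C1_on_def
proof (intro conjI ballI allI)
  show "(\<lambda>x. \<Sum>j\<in>J. f j x) differentiable at x" if "x \<in> \<Omega>" for x
    using C1_onD(1)[OF assms(1)] that assms(2) by (intro differentiable_sum) auto
  show "continuous_on \<Omega> (partial_deriv i (\<lambda>x. \<Sum>j\<in>J. f j x))" for i
    by (subst continuous_on_cong[OF refl partial_deriv_sum])
      (auto intro!: continuous_intros C1_onD[OF assms(1)])
qed

lemma C1_on_compose:
  assumes "C1_on \<Omega> f" "\<And>t. (g has_real_derivative g' t) (at t)" "continuous_on UNIV g'"
  shows "C1_on \<Omega> (\<lambda>x. g (f x))"
  unfolding C1_on_def
proof (intro conjI ballI allI)
  show "(\<lambda>x. g (f x)) differentiable at x" if "x \<in> \<Omega>" for x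
    using has_derivative_compose_real[OF C1_onD(1)[OF assms(1) that] assms(2)]
    by (auto simp: differentiable_def)
  have "continuous_on \<Omega> (\<lambda>x. g' (f x))"
    by (rule continuous_on_compose2[OF assms(3)]) (auto intro: C1_onD[OF assms(1)])
  then show "continuous_on \<Omega> (partial_deriv i (\<lambda>x. g (f x)))" for i
    by (subst continuous_on_cong[OF refl partial_deriv_compose[OF C1_onD(1)[OF assms(1)] assms(2)]])
      (auto intro!: continuous_intros C1_onD[OF assms(1)])
qed

lemma has_real_derivative_along_line:
  fixes f :: "real^'n::finite \<Rightarrow> real"
  assumes "(f has_derivative (\<lambda>h. \<Sum>i\<in>UNIV. d i * h $ i)) (at (x + t *\<^sub>R v))"
  shows "((\<lambda>s. f (x + s *\<^sub>R v)) has_real_derivative (\<Sum>i\<in>UNIV. d i * v $ i)) (at t within X)"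
proof -
  have "((\<lambda>s. x + s *\<^sub>R v) has_derivative (\<lambda>h. h *\<^sub>R v)) (at t within X)"
    by (auto intro!: derivative_eq_intros)
  note has_derivative_compose[OF this assms]
  moreover have "(\<lambda>h. \<Sum>i\<in>UNIV. d i * (h *\<^sub>R v) $ i) = (*) (\<Sum>i\<in>UNIV. d i * v $ i)"
    by (simp add: fun_eq_iff sum_distrib_left sum_distrib_right mult_ac)
  ultimately show ?thesis
    by (simp add: has_field_derivative_def)
qed

lemma sum_mult_axis:
  fixes g :: "'n::finite \<Rightarrow> real"
  shows "(\<Sum>j\<in>UNIV. g j * axis i 1 $ j) = g i"
proof -
  have "(\<Sum>j\<in>UNIV. g j * axis i 1 $ j) = (\<Sum>j\<in>UNIV. if j = i then g j else 0)"
    by (rule sum.cong) (auto simp: axis_def)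
  then show ?thesis by simp
qed

lemma has_real_derivative_along_axis:
  fixes f :: "real^'n::finite \<Rightarrow> real"
  assumes "f differentiable (at (x + t *\<^sub>R axis i 1))"
  shows "((\<lambda>s. f (x + s *\<^sub>R axis i 1)) has_real_derivative
    partial_deriv i f (x + t *\<^sub>R axis i 1)) (at t within X)"
  using has_real_derivative_along_line[OF has_derivative_partial_deriv[OF assms]] unfolding sum_mult_axis .

text \<open>
  The open sets \<open>\<Omega>\<close> and \<open>- S\<close> cover the space, and on the second one \<open>f\<close> vanishes.  This makes products of a cutoff with coefficients given on \<open>\<Omega>\<close> admissible in
  integrals over the whole space.
\<close>

lemma C1_on_zero_outside:
  assumes "open \<Omega>" "C1_on \<Omega> f" "closed S" "S \<subseteq> \<Omega>" "\<And>x. x \<notin> S \<Longrightarrow> f x = 0"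
  shows "C1_on UNIV f" "x \<notin> S \<Longrightarrow> partial_deriv i f x = 0"
proof -
  have der: "(f has_derivative (\<lambda>h. 0)) (at x)" if "x \<notin> S" for x
  proof -
    have "((\<lambda>x. 0::real) has_derivative (\<lambda>h. 0)) (at x)" by simp
    then show ?thesis
      by (rule has_derivative_transform_within_open[of _ _ _ _ "- S"])
        (use that assms in \<open>auto simp: open_Compl\<close>)
  qed
  then have zero: "partial_deriv i f x = 0" if "x \<notin> S" for x i
    using partial_deriv_eq that by fastforce
  then show "x \<notin> S \<Longrightarrow> partial_deriv i f x = 0" .
  have "f differentiable at x" for x
    using der C1_onD(1)[OF assms(2)] assms(4) by (cases "x \<in> S") (auto simp: differentiable_def)
  moreover have "continuous_on UNIV (partial_deriv i f)" for i
  proof -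
    have "continuous_on (- S) (partial_deriv i f)"
      by (rule continuous_on_eq[of _ "\<lambda>x. 0"]) (auto simp: zero)
    with C1_onD(2)[OF assms(2)] have "continuous_on (\<Omega> \<union> - S) (partial_deriv i f)"
      using assms by (intro continuous_on_open_Un) (auto simp: open_Compl)
    moreover have "\<Omega> \<union> - S = UNIV" using assms by auto
    ultimately show ?thesis by simp
  qed
  ultimately show "C1_on UNIV f" by (auto simp: C1_on_def)
qed

section \<open>Integrals of compactly supported partial derivatives\<close>

text \<open>
  The integral of a difference quotient vanishes by translation invariance.  The quotients
  converge to the partial derivative and are dominated by a bound for it on a slightly larger ball.
\<close>

lemma integral_partial_deriv_eq_0:
  fixes f :: "real^'n::finite \<Rightarrow> real"
  assumes C1: "C1_on UNIV f" and "compact S" and zero: "\<And>x. x \<notin> S \<Longrightarrow> f x = 0"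
  shows "integrable lborel (partial_deriv i f)" "(\<integral>x. partial_deriv i f x \<partial>lborel) = 0"
proof -
  let ?e = "axis i 1 :: real^'n"
  let ?D = "\<lambda>n x. real (Suc n) * (f (x + (1 / real (Suc n)) *\<^sub>R ?e) - f x)"
  have cf: "continuous_on UNIV f" and cpf: "continuous_on UNIV (partial_deriv i f)"
    using C1 by (auto intro: C1_onD)
  have [measurable]: "f \<in> borel_measurable borel" "partial_deriv i f \<in> borel_measurable borel"
    using cf cpf by (auto intro: borel_measurable_continuous_onI)
  have intf: "integrable lborel f"
  proof -
    have eq: "(\<lambda>x. indicator S x *\<^sub>R f x) = f"
      by (rule ext) (metis indicator_simps real_scaleR_def mult_1 mult_zero_left zero)
    show ?thesis
      using borel_integrable_compact[OF \<open>compact S\<close> continuous_on_subset[OF cf subset_UNIV]]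
      unfolding eq .
  qed
  have line: "((\<lambda>s. f (x + s *\<^sub>R ?e)) has_real_derivative partial_deriv i f (x + t *\<^sub>R ?e)) (at t)" for x t
    by (rule has_real_derivative_along_axis) (rule C1_onD(1)[OF C1 UNIV_I])
  obtain r where r: "S \<subseteq> cball 0 r"
    using bounded_subset_ballD[OF compact_imp_bounded[OF \<open>compact S\<close>], of 0] ball_subset_cball by (meson subset_trans)
  have "compact (partial_deriv i f ` cball 0 (r + 2))"
    by (intro compact_continuous_image continuous_on_subset[OF cpf] compact_cball) simp
  then obtain M where "\<forall>y\<in>partial_deriv i f ` cball 0 (r + 2). norm y \<le> M"
    using compact_imp_bounded bounded_iff by blast
  then have M: "\<And>x. x \<in> cball 0 (r + 2) \<Longrightarrow> \<bar>partial_deriv i f x\<bar> \<le> M"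
    by auto
  define h where "h = (\<lambda>x::real^'n. indicator (cball 0 (r + 1)) x * M)"
  have inth: "integrable lborel h"
    unfolding h_def using borel_integrable_compact[of "cball 0 (r+1)" "\<lambda>_. M"] by simp
  \<comment> \<open>Inside the ball of radius \<open>r + 1\<close> the mean value theorem applies; outside of it, both points of
    the difference quotient miss the support.\<close>
  have bound: "\<bar>?D n x\<bar> \<le> h x" for n x
  proof (cases "x \<in> cball 0 (r + 1)")
    case True
    obtain z where z: "0 < z" "z < 1 / real (Suc n)"
      "f (x + (1 / real (Suc n)) *\<^sub>R ?e) - f (x + 0 *\<^sub>R ?e) = (1 / real (Suc n) - 0) * partial_deriv i f (x + z *\<^sub>R ?e)"
      using MVT2[of 0 "1 / real (Suc n)" "\<lambda>s. f (x + s *\<^sub>R ?e)" "\<lambda>s. partial_deriv i f (x + s *\<^sub>R ?e)"] line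
      by auto
    have "1 / real (Suc n) \<le> 1" by simp
    with z(2) have "z \<le> 1" by linarith
    with z(1) have "norm (z *\<^sub>R ?e) \<le> 1" by (simp add: norm_axis_1)
    then have "norm (x + z *\<^sub>R ?e) \<le> r + 2"
      using True norm_triangle_ineq[of x "z *\<^sub>R ?e"] by simp
    then have "\<bar>partial_deriv i f (x + z *\<^sub>R ?e)\<bar> \<le> M"
      by (intro M) simp
    moreover have "?D n x = partial_deriv i f (x + z *\<^sub>R ?e)"
      using z(3) by (simp add: field_simps del: of_nat_Suc)
    ultimately show ?thesis using True by (simp add: h_def)
  next
    case False
    have "1 / real (Suc n) \<le> 1" by simp
    then have "norm ((1 / real (Suc n)) *\<^sub>R ?e) \<le> 1" by (simp add: norm_axis_1)
    then have "norm (x + (1 / real (Suc n)) *\<^sub>R ?e) > r"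
      using False norm_triangle_ineq4[of "x + (1 / real (Suc n)) *\<^sub>R ?e" "(1 / real (Suc n)) *\<^sub>R ?e"]
      by (simp only: add_diff_cancel_right' mem_cball_0)
    then have "f (x + (1 / real (Suc n)) *\<^sub>R ?e) = 0" "f x = 0"
      using False r by (auto intro!: zero simp: subset_iff)
    then show ?thesis using False by (simp add: h_def)
  qed
  have lim: "(\<lambda>n. ?D n x) \<longlonglongrightarrow> partial_deriv i f x" for x
  proof -
    have "((\<lambda>s. (f (x + s *\<^sub>R ?e) - f x) / s) \<longlongrightarrow> partial_deriv i f x) (at 0)"
      using line[of x 0] by (simp add: DERIV_def)
    moreover have "filterlim (\<lambda>n. 1 / real (Suc n)) (at 0) sequentially"
      unfolding filterlim_at by (auto intro: LIMSEQ_inverse_real_of_nat[unfolded inverse_eq_divide] simp del: of_nat_Suc)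
    ultimately have "(\<lambda>n. (f (x + (1 / real (Suc n)) *\<^sub>R ?e) - f x) / (1 / real (Suc n))) \<longlonglongrightarrow> partial_deriv i f x"
      by (rule filterlim_compose)
    then show ?thesis by (simp add: mult.commute)
  qed
  have zeroint: "(\<integral>x. ?D n x \<partial>lborel) = 0" for n
  proof -
    let ?t = "(1 / real (Suc n)) *\<^sub>R ?e"
    have "integrable (distr lborel borel ((+) ?t)) f" "(\<integral>x. f x \<partial>distr lborel borel ((+) ?t)) = (\<integral>x. f x \<partial>lborel)"
      using intf by (simp_all add: lborel_distr_plus)
    then have "integrable lborel (\<lambda>x. f (x + ?t))" "(\<integral>x. f (x + ?t) \<partial>lborel) = (\<integral>x. f x \<partial>lborel)"
      by (simp_all add: integrable_distr_eq integral_distr add.commute)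
    then show ?thesis using intf by simp
  qed
  have D_meas: "(\<lambda>x. ?D n x) \<in> borel_measurable lborel" for n
    by measurable
  show "integrable lborel (partial_deriv i f)"
    by (rule integrable_dominated_convergence[where w=h and s="?D"])
      (use bound lim inth D_meas in simp_all)
  have "(\<lambda>n. \<integral>x. ?D n x \<partial>lborel) \<longlonglongrightarrow> (\<integral>x. partial_deriv i f x \<partial>lborel)"
    by (rule integral_dominated_convergence[where w=h])
      (use bound lim inth D_meas in simp_all)
  then show "(\<integral>x. partial_deriv i f x \<partial>lborel) = 0"
    unfolding zeroint by (simp add: LIMSEQ_const_iff)
qed

section \<open>The weak maximum principle\<close>

lemma second_derivative_test_max:
  fixes f f' :: "real \<Rightarrow> real"
  assumes "0 < d" and f: "\<And>t. \<bar>t\<bar> < d \<Longrightarrow> (f has_real_derivative f' t) (at t)"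
    and f': "(f' has_real_derivative L) (at 0)" and max: "\<And>t. \<bar>t\<bar> < d \<Longrightarrow> f t \<le> f 0"
  shows "f' 0 = 0" "L \<le> 0"
proof -
  show 0: "f' 0 = 0"
    using DERIV_local_max[OF f[of 0] \<open>0 < d\<close>] max \<open>0 < d\<close> by simp
  show "L \<le> 0"
  proof (rule ccontr)
    assume "\<not> L \<le> 0"
    then obtain e where e: "0 < e" "\<And>h. 0 < h \<Longrightarrow> h < e \<Longrightarrow> f' 0 < f' (0 + h)"
      using DERIV_pos_inc_right[OF f'] by auto
    define t where "t = min d e / 2"
    have t: "0 < t" "t < d" "t < e" using \<open>0 < d\<close> \<open>0 < e\<close> by (auto simp: t_def)
    then obtain z where z: "0 < z" "z < t" "f t - f 0 = (t - 0) * f' z"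
      using MVT2[of 0 t f f'] f by auto
    then have "0 < f' z" using e(2)[of z] 0 t by simp
    then have "f 0 < f t" using z t by (smt (verit) mult_pos_pos)
    with max[of t] t show False by simp
  qed
qed

text \<open>
  Completing the square writes \<open>A\<^sub>1\<^sub>1 A\<close> as the rank-one matrix of the first row of \<open>A\<close> plus
  \<open>det A\<close> times the projection to the second axis, so the trace of \<open>A H\<close> is a nonnegative
  combination of two values of the quadratic form of \<open>H\<close>.
\<close>

lemma sum_mult_nonpos_of_definite:
  fixes A H :: "2 \<Rightarrow> 2 \<Rightarrow> real"
  assumes sym: "\<And>i j. A i j = A j i" and pos: "0 < A 1 1"
    and A: "\<And>v::real^2. 0 \<le> (\<Sum>i\<in>UNIV. \<Sum>j\<in>UNIV. A i j * v $ i * v $ j)"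
    and H: "\<And>v::real^2. (\<Sum>i\<in>UNIV. \<Sum>j\<in>UNIV. H i j * v $ i * v $ j) \<le> 0"
  shows "(\<Sum>i\<in>UNIV. \<Sum>j\<in>UNIV. A i j * H i j) \<le> 0"
proof -
  have s: "A 2 1 = A 1 2" by (rule sym)
  have "0 \<le> A 1 1 * (A 1 1 * A 2 2 - A 1 2 * A 1 2)"
    using A[of "vector [- A 1 2, A 1 1]"] by (simp add: sum_2 s algebra_simps)
  with pos have det: "0 \<le> A 1 1 * A 2 2 - A 1 2 * A 1 2"
    by (simp add: zero_le_mult_iff)
  have "H 2 2 \<le> 0"
    using H[of "vector [0, 1]"] by (simp add: sum_2)
  with det have "(A 1 1 * A 2 2 - A 1 2 * A 1 2) * H 2 2 \<le> 0"
    by (rule mult_nonneg_nonpos)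
  moreover have "H 1 1 * A 1 1 * A 1 1 + H 1 2 * A 1 1 * A 1 2 + H 2 1 * A 1 2 * A 1 1
      + H 2 2 * A 1 2 * A 1 2 \<le> 0"
    using H[of "vector [A 1 1, A 1 2]"] by (simp add: sum_2)
  ultimately have "A 1 1 * (\<Sum>i\<in>UNIV. \<Sum>j\<in>UNIV. A i j * H i j) \<le> 0"
    by (simp add: sum_2 s algebra_simps)
  with pos show ?thesis by (simp add: mult_le_0_iff)
qed

text \<open>
  The functions \<open>du\<close> and \<open>ddu\<close> are the first and second partial derivatives of \<open>u\<close>; having them as
  parameters lets the same statement apply to \<open>u\<close> and to \<open>-u\<close>.  An interior maximum that exceeds \<open>M\<close>
  survives the addition of a small multiple of \<open>exp (k x\<^sub>1)\<close>.  At the new maximum the gradient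
  vanishes and the Hessian is nonpositive, while for large \<open>k\<close> the operator is strictly positive on
  the exponential, which contradicts the differential inequality.
\<close>

lemma weak_maximum_principle:
  fixes u :: "real^2 \<Rightarrow> real" and A :: "2 \<Rightarrow> 2 \<Rightarrow> real^2 \<Rightarrow> real"
  assumes U: "open U" "bounded U" and cont: "continuous_on (closure U) u"
    and du: "\<And>x. x \<in> U \<Longrightarrow> (u has_derivative (\<lambda>h. \<Sum>j\<in>UNIV. du j x * h $ j)) (at x)"
    and ddu: "\<And>x j. x \<in> U \<Longrightarrow> (du j has_derivative (\<lambda>h. \<Sum>i\<in>UNIV. ddu i j x * h $ i)) (at x)"
    and sym: "\<And>x i j. x \<in> U \<Longrightarrow> A i j x = A j i x"
    and "0 < l" and ell: "\<And>x v::real^2. x \<in> U \<Longrightarrow>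
      l * (norm v)\<^sup>2 \<le> (\<Sum>i\<in>UNIV. \<Sum>j\<in>UNIV. A i j x * v $ i * v $ j)"
    and B: "\<And>x. x \<in> U \<Longrightarrow> \<bar>B 1 x\<bar> \<le> N"
    and sub: "\<And>x. x \<in> U \<Longrightarrow> 0 < u x \<Longrightarrow>
      0 \<le> (\<Sum>i\<in>UNIV. \<Sum>j\<in>UNIV. A i j x * ddu i j x) + (\<Sum>j\<in>UNIV. B j x * du j x)"
    and M: "0 \<le> M" "\<And>x. x \<in> frontier U \<Longrightarrow> u x \<le> M"
    and "y \<in> U"
  shows "u y \<le> M"
proof (rule ccontr)
  assume "\<not> u y \<le> M"
  have "compact (closure U)" using U(2) by (simp add: compact_eq_bounded_closed bounded_closure)
  define k where "k = (\<bar>N\<bar> + 1) / l"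
  have k: "0 < k" "N < l * k" using \<open>0 < l\<close> by (auto simp: k_def)
  have "compact ((\<lambda>x. exp (k * x $ 1)) ` closure U)"
    by (intro compact_continuous_image continuous_intros \<open>compact (closure U)\<close>)
  then obtain E where E: "\<forall>z\<in>(\<lambda>x. exp (k * x $ 1)) ` closure U. norm z \<le> E"
    using compact_imp_bounded bounded_iff by blast
  have Ex: "exp (k * x $ 1) \<le> E" if "x \<in> closure U" for x
    using bspec[OF E imageI[OF that]] by simp
  have "y \<in> closure U" using \<open>y \<in> U\<close> closure_subset by auto
  have "0 < E" using Ex[OF \<open>y \<in> closure U\<close>] exp_gt_zero[of "k * y $ 1"] by linarith
  \<comment> \<open>So small that the added exponential cannot move the maximum to the frontier.\<close>
  define \<epsilon> where "\<epsilon> = (u y - M) / (2 * E)"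
  have \<epsilon>: "0 < \<epsilon>" "\<epsilon> * E < u y - M"
    using \<open>\<not> u y \<le> M\<close> \<open>0 < E\<close> by (auto simp: \<epsilon>_def field_simps)
  define w where "w = (\<lambda>x. u x + \<epsilon> * exp (k * x $ 1))"
  have "continuous_on (closure U) w"
    unfolding w_def by (intro continuous_intros cont)
  then obtain z where z: "z \<in> closure U" "\<And>x. x \<in> closure U \<Longrightarrow> w x \<le> w z"
    using continuous_attains_sup[OF \<open>compact (closure U)\<close>] \<open>y \<in> closure U\<close> by (metis empty_iff)
  have "u y \<le> w z"
  proof -
    have "0 \<le> \<epsilon> * exp (k * y $ 1)" using \<epsilon>(1) by simp
    then have "u y \<le> w y" by (simp add: w_def)
    also have "\<dots> \<le> w z" by (rule z(2)[OF \<open>y \<in> closure U\<close>])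
    finally show ?thesis .
  qed
  moreover have "\<epsilon> * exp (k * z $ 1) \<le> \<epsilon> * E"
    using Ex[OF z(1)] \<epsilon>(1) by simp
  ultimately have "M < u z" using \<epsilon>(2) by (simp add: w_def)
  then have "z \<notin> frontier U" using M(2) by force
  then have "z \<in> U" using z(1) U by (simp add: frontier_def interior_open)
  define X where "X = \<epsilon> * exp (k * z $ 1)"
  have "0 < X" using \<epsilon> by (simp add: X_def)
  obtain \<delta> where \<delta>: "0 < \<delta>" "ball z \<delta> \<subseteq> U"
    using \<open>z \<in> U\<close> U(1) open_contains_ball by blast
  \<comment> \<open>Along every line through \<open>z\<close> the restriction of \<open>w\<close> has a local maximum.\<close>
  have line: "(\<Sum>j\<in>UNIV. du j z * v $ j) + X * k * v $ 1 = 0 \<and>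
      (\<Sum>j\<in>UNIV. (\<Sum>i\<in>UNIV. ddu i j z * v $ i) * v $ j) + X * k * k * v $ 1 * v $ 1 \<le> 0" for v :: "real^2"
  proof -
    define d where "d = \<delta> / (norm v + 1)"
    have "0 < d" using \<delta>(1) by (simp add: d_def add_nonneg_pos)
    have inU: "z + t *\<^sub>R v \<in> U" if "\<bar>t\<bar> < d" for t
    proof -
      have "\<bar>t\<bar> * norm v \<le> \<bar>t\<bar> * (norm v + 1)" by (intro mult_left_mono) auto
      also have "\<dots> < \<delta>" using that by (simp add: d_def pos_less_divide_eq add_nonneg_pos)
      finally show ?thesis using \<delta>(2) by (auto simp: dist_norm)
    qed
    define f' where "f' = (\<lambda>t. (\<Sum>j\<in>UNIV. du j (z + t *\<^sub>R v) * v $ j)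
        + \<epsilon> * exp (k * (z + t *\<^sub>R v) $ 1) * k * v $ 1)"
    have "((\<lambda>t. w (z + t *\<^sub>R v)) has_real_derivative f' t) (at t)" if "\<bar>t\<bar> < d" for t
      unfolding w_def f'_def
      by (rule derivative_eq_intros has_real_derivative_along_line[OF du[OF inU[OF that]]] refl)+
        (auto intro!: derivative_eq_intros simp: algebra_simps)
    moreover have "(f' has_real_derivative (\<Sum>j\<in>UNIV. (\<Sum>i\<in>UNIV. ddu i j z * v $ i) * v $ j)
        + X * k * k * v $ 1 * v $ 1) (at 0)"
    proof -
      have *: "((\<lambda>t. du j (z + t *\<^sub>R v)) has_real_derivative (\<Sum>i\<in>UNIV. ddu i j z * v $ i)) (at 0)" for j
        by (rule has_real_derivative_along_line) (use ddu[OF \<open>z \<in> U\<close>] in simp)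
      show ?thesis
        unfolding f'_def
        by (rule derivative_eq_intros * refl)+ (auto intro!: derivative_eq_intros simp: X_def algebra_simps)
    qed
    moreover have "w (z + t *\<^sub>R v) \<le> w (z + 0 *\<^sub>R v)" if "\<bar>t\<bar> < d" for t
      using z(2) inU[OF that] closure_subset by auto
    ultimately have "f' 0 = 0 \<and> (\<Sum>j\<in>UNIV. (\<Sum>i\<in>UNIV. ddu i j z * v $ i) * v $ j)
        + X * k * k * v $ 1 * v $ 1 \<le> 0"
      using second_derivative_test_max[OF \<open>0 < d\<close>, of "\<lambda>t. w (z + t *\<^sub>R v)" f'] by blast
    then show ?thesis by (simp add: f'_def X_def mult_ac)
  qed
  have du_z: "du 1 z = - (X * k)" "du 2 z = 0"
    using line[of "vector [1, 0]"] line[of "vector [0, 1]"] by (simp_all add: sum_2)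
  have a11: "l \<le> A 1 1 z"
  proof -
    have "(axis 1 1 :: real^2) $ 1 = 1" "(axis 1 1 :: real^2) $ 2 = 0"
      by (simp_all add: axis_def)
    then show ?thesis
      using ell[OF \<open>z \<in> U\<close>, of "axis 1 1"] by (simp add: sum_2 norm_axis_1)
  qed
  define H where "H = (\<lambda>i j. ddu i j z + (if i = 1 \<and> j = 1 then X * k * k else 0))"
  have "(\<Sum>i\<in>UNIV. \<Sum>j\<in>UNIV. A i j z * H i j) \<le> 0"
  proof (rule sum_mult_nonpos_of_definite)
    show "0 < A 1 1 z" using a11 \<open>0 < l\<close> by simp
    show "0 \<le> (\<Sum>i\<in>UNIV. \<Sum>j\<in>UNIV. A i j z * v $ i * v $ j)" for v :: "real^2"
      using ell[OF \<open>z \<in> U\<close>, of v] \<open>0 < l\<close> by (smt (verit) mult_nonneg_nonneg zero_le_power2)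
    show "(\<Sum>i\<in>UNIV. \<Sum>j\<in>UNIV. H i j * v $ i * v $ j) \<le> 0" for v :: "real^2"
      using line[of v] by (simp add: H_def sum_2 algebra_simps)
  qed (rule sym[OF \<open>z \<in> U\<close>])
  then have "(\<Sum>i\<in>UNIV. \<Sum>j\<in>UNIV. A i j z * ddu i j z) + A 1 1 z * X * k * k \<le> 0"
    by (simp add: H_def sum_2 algebra_simps)
  moreover have "0 \<le> (\<Sum>i\<in>UNIV. \<Sum>j\<in>UNIV. A i j z * ddu i j z) + (\<Sum>j\<in>UNIV. B j z * du j z)"
    using sub[OF \<open>z \<in> U\<close>] \<open>M < u z\<close> M(1) by simp
  ultimately have "X * k * (A 1 1 z * k + B 1 z) \<le> 0"
    by (simp add: sum_2 du_z algebra_simps)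
  then have "A 1 1 z * k + B 1 z \<le> 0"
    using \<open>0 < X\<close> k by (simp add: mult_le_0_iff)
  moreover have "l * k \<le> A 1 1 z * k" using a11 k by simp
  ultimately show False using k(2) B[OF \<open>z \<in> U\<close>] by linarith
qed

text \<open>
  Carrying out the derivatives in the divergence form puts the equation into the form required by
  the maximum principle, with right-hand side \<open>c u\<close>, which is nonnegative where
  \<open>u\<close> is positive; the same holds for \<open>-u\<close>.
\<close>

lemma abs_le_of_frontier:
  fixes u c :: "real^2 \<Rightarrow> real" and b :: "real^2 \<Rightarrow> real^2" and a :: "2 \<Rightarrow> 2 \<Rightarrow> real^2 \<Rightarrow> real"
  assumes a_C1: "\<And>i j. C1_on \<Omega> (a i j)" and b_C1: "\<And>i. C1_on \<Omega> (\<lambda>x. b x $ i)"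
    and u_C2: "C2_on \<Omega> u"
    and sym: "\<And>i j x. x \<in> \<Omega> \<Longrightarrow> a i j x = a j i x"
    and "0 < l" and ell: "\<And>x v::real^2. x \<in> \<Omega> \<Longrightarrow>
      l * (norm v)\<^sup>2 \<le> (\<Sum>i\<in>UNIV. \<Sum>j\<in>UNIV. a i j x * v $ i * v $ j)"
    and c_nonneg: "\<And>x. x \<in> \<Omega> \<Longrightarrow> 0 \<le> c x"
    and pde: "\<And>x. x \<in> \<Omega> \<Longrightarrow>
          - (\<Sum>i\<in>UNIV. \<Sum>j\<in>UNIV. partial_deriv i (\<lambda>y. a i j y * partial_deriv j u y) x)
            + b x \<bullet> grad u x + c x * u x = 0"
    and U: "open U" "bounded U" "closure U \<subseteq> \<Omega>"
    and M: "0 \<le> M" "\<And>x. x \<in> frontier U \<Longrightarrow> \<bar>u x\<bar> \<le> M" and y: "y \<in> U"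
  shows "\<bar>u y\<bar> \<le> M"
proof -
  have u_C1: "C1_on \<Omega> u" and du_C1: "\<And>j. C1_on \<Omega> (partial_deriv j u)"
    using u_C2 by (auto simp: C2_on_def)
  have U\<Omega>: "x \<in> \<Omega>" if "x \<in> U" for x using that U(3) closure_subset by blast
  define B where "B = (\<lambda>j x. (\<Sum>i\<in>UNIV. partial_deriv i (a i j) x) - b x $ j)"
  have expand: "(\<Sum>i\<in>UNIV. \<Sum>j\<in>UNIV. a i j x * partial_deriv i (partial_deriv j u) x)
      + (\<Sum>j\<in>UNIV. B j x * partial_deriv j u x) = c x * u x" if "x \<in> \<Omega>" for x
  proof -
    have "partial_deriv i (\<lambda>y. a i j y * partial_deriv j u y) x
        = a i j x * partial_deriv i (partial_deriv j u) x + partial_deriv i (a i j) x * partial_deriv j u x" for i j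
      by (rule partial_deriv_mult[OF C1_onD(1)[OF a_C1 that] C1_onD(1)[OF du_C1 that]])
    then show ?thesis
      using pde[OF that] by (simp add: B_def sum_2 inner_vec_def grad_def algebra_simps)
  qed
  have "continuous_on (closure U) (B 1)"
    unfolding B_def
    by (intro continuous_intros continuous_on_subset[OF C1_onD(2)[OF a_C1] U(3)]
        continuous_on_subset[OF C1_onD(3)[OF b_C1] U(3)])
  moreover have "compact (closure U)"
    using U(2) by (simp add: compact_eq_bounded_closed bounded_closure)
  ultimately have "bounded (B 1 ` closure U)"
    by (intro compact_imp_bounded compact_continuous_image)
  then obtain N where "\<forall>z\<in>B 1 ` closure U. norm z \<le> N" using bounded_iff by blast
  then have N: "\<bar>B 1 x\<bar> \<le> N" if "x \<in> U" for x
    using that closure_subset by fastforce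
  have le: "\<sigma> * u y \<le> M" if \<sigma>: "\<bar>\<sigma>\<bar> = 1" for \<sigma>
  proof (rule weak_maximum_principle[where u = "\<lambda>x. \<sigma> * u x" and du = "\<lambda>j x. \<sigma> * partial_deriv j u x"
        and ddu = "\<lambda>i j x. \<sigma> * partial_deriv i (partial_deriv j u) x" and A = a and B = B and N = N
        and U = U and l = l])
    show "open U" "bounded U" "0 < l" "0 \<le> M" "y \<in> U" by fact+
    show "continuous_on (closure U) (\<lambda>x. \<sigma> * u x)"
      by (intro continuous_intros continuous_on_subset[OF C1_onD(3)[OF u_C1] U(3)])
    fix x assume x: "x \<in> U"
    show "((\<lambda>x. \<sigma> * u x) has_derivative (\<lambda>h. \<Sum>j\<in>UNIV. \<sigma> * partial_deriv j u x * h $ j)) (at x)"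
      using has_derivative_mult_right[OF has_derivative_partial_deriv[OF C1_onD(1)[OF u_C1 U\<Omega>[OF x]]], of \<sigma>]
      by (simp add: sum_distrib_left mult.assoc)
    show "((\<lambda>x. \<sigma> * partial_deriv j u x) has_derivative
        (\<lambda>h. \<Sum>i\<in>UNIV. \<sigma> * partial_deriv i (partial_deriv j u) x * h $ i)) (at x)" for j
      using has_derivative_mult_right[OF has_derivative_partial_deriv[OF C1_onD(1)[OF du_C1[of j] U\<Omega>[OF x]]], of \<sigma>]
      by (simp add: sum_distrib_left mult.assoc)
    show "\<bar>B 1 x\<bar> \<le> N" by (rule N[OF x])
    show "a i j x = a j i x" for i j by (rule sym[OF U\<Omega>[OF x]])
    show "l * (norm v)\<^sup>2 \<le> (\<Sum>i\<in>UNIV. \<Sum>j\<in>UNIV. a i j x * v $ i * v $ j)" for v :: "real^2"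
      by (rule ell[OF U\<Omega>[OF x]])
    assume "0 < \<sigma> * u x"
    then have "0 \<le> c x * (\<sigma> * u x)" using c_nonneg[OF U\<Omega>[OF x]] by simp
    also have "\<dots> = \<sigma> * (c x * u x)" by simp
    finally show "0 \<le> (\<Sum>i\<in>UNIV. \<Sum>j\<in>UNIV. a i j x * (\<sigma> * partial_deriv i (partial_deriv j u) x))
        + (\<Sum>j\<in>UNIV. B j x * (\<sigma> * partial_deriv j u x))"
      unfolding expand[OF U\<Omega>[OF x], symmetric] by (simp add: sum_2 algebra_simps)
  next
    fix x assume "x \<in> frontier U"
    have "\<sigma> * u x \<le> \<bar>\<sigma>\<bar> * \<bar>u x\<bar>" by (simp flip: abs_mult)
    then show "\<sigma> * u x \<le> M" using M(2)[OF \<open>x \<in> frontier U\<close>] \<sigma> by simp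
  qed
  show ?thesis using le[of 1] le[of "-1"] by (simp add: abs_le_iff)
qed

section \<open>Pointwise bounds on boundaries of squares\<close>

text \<open>
  For \<open>\<sigma> = 1\<close> and \<open>\<sigma> = -1\<close> and for \<open>i = 1\<close> and \<open>i = 2\<close>, the maps \<open>y \<mapsto> side_point i \<sigma> s y\<close> on \<open>[-s, s]\<close>
  parametrize the four sides of the boundary of the square \<open>infnorm x \<le> s\<close>.
\<close>

definition side_point :: "2 \<Rightarrow> real \<Rightarrow> real \<Rightarrow> real \<Rightarrow> real^2"
  where "side_point i \<sigma> s y = (\<sigma> * s) *\<^sub>R axis i 1 + y *\<^sub>R axis (if i = 1 then 2 else 1) 1"

lemma side_point_nth:
  "side_point i \<sigma> s y $ j = (if j = i then \<sigma> * s else y)"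
  using exhaust_2[of i] exhaust_2[of j] by (auto simp: side_point_def axis_def)

lemma continuous_side_point: "continuous_on S (\<lambda>p. side_point i \<sigma> (fst p) (snd p))"
  unfolding side_point_def by (intro continuous_intros)

text \<open>
  The parametrization is a linear isometry from pairs to vectors; this transfers Fubini's theorem
  from the product type to the plane.
\<close>

lemma lborel_distr_side_point:
  assumes "\<sigma> = 1 \<or> \<sigma> = -1"
  shows "distr lborel borel (\<lambda>p. side_point i \<sigma> (fst p) (snd p)) = lborel"
proof (rule lborel_eqI[symmetric])
  let ?T = "\<lambda>p. side_point i \<sigma> (fst p) (snd p)"
  fix l u :: "real^2"
  assume le': "\<And>b. b \<in> Basis \<Longrightarrow> l \<bullet> b \<le> u \<bullet> b"
  have le: "l $ j \<le> u $ j" for j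
    using le'[of "axis j 1"] by (simp add: inner_axis axis_in_Basis_iff)
  let ?k = "if i = 1 then 2 else 1 :: 2"
  let ?a = "if \<sigma> = 1 then l $ i else - (u $ i)" and ?b = "if \<sigma> = 1 then u $ i else - (l $ i)"
  have T[measurable]: "?T \<in> borel_measurable borel"
    by (intro borel_measurable_continuous_onI continuous_side_point)
  have vim: "?T -` box l u \<inter> space lborel = {?a<..<?b} \<times> {l $ ?k<..<u $ ?k}"
    using assms exhaust_2[of i]
    by (auto simp: mem_box_cart side_point_nth forall_2)
  have "emeasure (distr lborel borel ?T) (box l u) = emeasure lborel ({?a<..<?b} \<times> {l $ ?k<..<u $ ?k})"
    by (subst emeasure_distr) (use vim T in auto)
  also have "\<dots> = emeasure lborel {?a<..<?b} * emeasure lborel {l $ ?k<..<u $ ?k}"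
    unfolding lborel_prod[symmetric] by (rule lborel.emeasure_pair_measure_Times) auto
  also have "\<dots> = ennreal ((u $ i - l $ i) * (u $ ?k - l $ ?k))"
    using le[of i] le[of ?k] by (auto simp: ennreal_mult)
  also have "(u $ i - l $ i) * (u $ ?k - l $ ?k) = (\<Prod>j\<in>UNIV. (u - l) $ j)"
    using exhaust_2[of i] by (auto simp: UNIV_2)
  also have "\<dots> = (\<Prod>b\<in>Basis. (u - l) \<bullet> b)"
  proof -
    have B: "(Basis :: (real^2) set) = range (\<lambda>j. axis j 1)" by (auto simp: Basis_vec_def)
    have "inj (\<lambda>j. axis j 1 :: real^2)" by (auto simp: inj_def axis_eq_axis)
    then show ?thesis unfolding B by (subst prod.reindex) (auto simp: inner_axis)
  qed
  finally show "emeasure (distr lborel borel ?T) (box l u) = (\<Prod>b\<in>Basis. (u - l) \<bullet> b)" .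
qed simp

lemma compact_square_annulus: "compact {x::real^2. r \<le> infnorm x \<and> infnorm x \<le> s}"
proof -
  have "closed {x::real^2. r \<le> infnorm x \<and> infnorm x \<le> s}"
    by (intro closed_Collect_conj closed_Collect_le continuous_intros)
  moreover have "bounded {x::real^2. r \<le> infnorm x \<and> infnorm x \<le> s}"
  proof (rule boundedI)
    fix x :: "real^2" assume "x \<in> {x. r \<le> infnorm x \<and> infnorm x \<le> s}"
    then have "infnorm x \<le> s" by simp
    then have "sqrt 2 * infnorm x \<le> sqrt 2 * s" by simp
    moreover have "norm x \<le> sqrt 2 * infnorm x" using norm_le_infnorm[of x] by simp
    ultimately show "norm x \<le> sqrt 2 * s" by linarith
  qed
  ultimately show ?thesis by (simp add: compact_eq_bounded_closed)
qed

text \<open>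
  Sides are extended to the length \<open>4 R\<close> of the largest square, so that \<open>(s, y)\<close> ranges over a
  rectangle; its image stays inside the square shell.
\<close>

lemma integral_side_le:
  fixes h :: "real^2 \<Rightarrow> real"
  defines "Q R \<equiv> {x::real^2. R \<le> infnorm x \<and> infnorm x \<le> 2 * R}"
  assumes "\<sigma> = 1 \<or> \<sigma> = -1" and "0 < R" and cont: "continuous_on (Q R) h"
    and nn: "\<And>x. x \<in> Q R \<Longrightarrow> 0 \<le> h x"
  shows "continuous_on {R..2*R} (\<lambda>s. integral {-2*R..2*R} (\<lambda>y. h (side_point i \<sigma> s y)))"
    and "integral {R..2*R} (\<lambda>s. integral {-2*R..2*R} (\<lambda>y. h (side_point i \<sigma> s y)))
      \<le> (LINT x:Q R|lborel. h x)"
proof -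
  let ?T = "\<lambda>p. side_point i \<sigma> (fst p) (snd p)"
  let ?C = "cbox (R, -2*R) (2*R, 2*R)"
  have TQ: "?T p \<in> Q R" if "p \<in> ?C" for p
  proof -
    have "\<bar>?T p $ j\<bar> = (if j = i then \<bar>fst p\<bar> else \<bar>snd p\<bar>)" for j
      using assms(2) by (auto simp: side_point_nth abs_mult)
    moreover have "R \<le> fst p" "fst p \<le> 2 * R" "\<bar>snd p\<bar> \<le> 2 * R"
      using that by (cases p, auto)+
    ultimately show ?thesis
      using exhaust_2[of i] \<open>0 < R\<close> by (auto simp: Q_def infnorm_2)
  qed
  have contT: "continuous_on ?C (\<lambda>p. h (?T p))"
    by (rule continuous_on_compose2[OF cont continuous_side_point]) (use TQ in auto)
  have C: "?C = {R..2*R} \<times> {-2*R..2*R}" by (auto simp: cbox_Pair_eq)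
  show "continuous_on {R..2*R} (\<lambda>s. integral {-2*R..2*R} (\<lambda>y. h (side_point i \<sigma> s y)))"
    using integral_continuous_on_param[of "{R..2*R}" "-2*R" "2*R" "\<lambda>s y. h (side_point i \<sigma> s y)"]
      contT unfolding C by (simp add: case_prod_beta)
  have comp: "compact (Q R)" unfolding Q_def by (rule compact_square_annulus)
  have intA: "integrable lborel (\<lambda>x. indicator (Q R) x *\<^sub>R h x)"
    by (rule borel_integrable_compact[OF comp cont])
  have intC: "set_integrable lborel ?C (\<lambda>p. h (?T p))"
    unfolding set_integrable_def by (rule borel_integrable_compact[OF compact_cbox contT])
  have T: "?T \<in> borel_measurable lborel"
    using borel_measurable_continuous_onI[OF continuous_side_point] by simp
  have D: "distr lborel borel ?T = lborel" by (rule lborel_distr_side_point[OF assms(2)])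
  have hb: "(\<lambda>x. indicator (Q R) x *\<^sub>R h x) \<in> borel_measurable borel"
    using intA by auto
  have intT: "integrable lborel (\<lambda>p. indicator (Q R) (?T p) *\<^sub>R h (?T p))"
    using intA integrable_distr_eq[OF T hb] unfolding D by simp
  have "integral {R..2*R} (\<lambda>s. integral {-2*R..2*R} (\<lambda>y. h (side_point i \<sigma> s y)))
      = integral ?C (\<lambda>p. h (?T p))"
    using integral_prod_continuous[OF contT] by simp
  also have "\<dots> = (LINT p:?C|lborel. h (?T p))"
    by (rule set_borel_integral_eq_integral(2)[OF intC, symmetric])
  also have "\<dots> \<le> (\<integral>p. indicator (Q R) (?T p) *\<^sub>R h (?T p) \<partial>lborel)"
    unfolding set_lebesgue_integral_def
  proof (rule integral_mono[OF intC[unfolded set_integrable_def] intT])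
    fix p show "indicator ?C p *\<^sub>R h (?T p) \<le> indicator (Q R) (?T p) *\<^sub>R h (?T p)"
      using TQ[of p] nn[of "?T p"] by (auto simp: indicator_def)
  qed
  also have "\<dots> = (\<integral>x. indicator (Q R) x *\<^sub>R h x \<partial>distr lborel borel ?T)"
    by (rule integral_distr[OF T hb, symmetric])
  finally show "integral {R..2*R} (\<lambda>s. integral {-2*R..2*R} (\<lambda>y. h (side_point i \<sigma> s y)))
      \<le> (LINT x:Q R|lborel. h x)"
    unfolding D set_lebesgue_integral_def .
qed

lemma exists_le_integral_mean:
  fixes f :: "real \<Rightarrow> real"
  assumes "a < b" "continuous_on {a..b} f"
  shows "\<exists>s\<in>{a..b}. f s * (b - a) \<le> integral {a..b} f"
proof -
  obtain s where s: "s \<in> {a..b}" "\<And>t. t \<in> {a..b} \<Longrightarrow> f s \<le> f t"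
    using continuous_attains_inf[of "{a..b}" f] assms by auto
  have "integral {a..b} (\<lambda>_. f s) \<le> integral {a..b} f"
    using s assms by (intro integral_le integrable_continuous_interval) auto
  with s(1) \<open>a < b\<close> show ?thesis by (auto simp: mult.commute)
qed

text \<open>
  Some value of \<open>f\<close> does not exceed the mean, and the oscillation of \<open>f\<close> is at most the integral of
  \<open>|f'|\<close>.
\<close>

lemma le_mean_plus_variation:
  fixes f f' :: "real \<Rightarrow> real"
  assumes "a < b" and f: "\<And>t. t \<in> {a..b} \<Longrightarrow> (f has_real_derivative f' t) (at t within {a..b})"
    and cont: "continuous_on {a..b} f'" and t: "t \<in> {a..b}"
  shows "f t \<le> integral {a..b} f / (b - a) + integral {a..b} (\<lambda>x. \<bar>f' x\<bar>)"
proof -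
  have "continuous_on {a..b} f"
    using f by (meson DERIV_continuous_on)
  then obtain s where s: "s \<in> {a..b}" "f s * (b - a) \<le> integral {a..b} f"
    using exists_le_integral_mean[OF \<open>a < b\<close>] by blast
  have sub: "f y - f x \<le> integral {a..b} (\<lambda>x. \<bar>f' x\<bar>)" "f x - f y \<le> integral {a..b} (\<lambda>x. \<bar>f' x\<bar>)"
    if "x \<in> {a..b}" "y \<in> {a..b}" "x \<le> y" for x y
  proof -
    have "(f' has_integral f y - f x) {x..y}"
    proof (rule fundamental_theorem_of_calculus[OF \<open>x \<le> y\<close>])
      fix z assume "z \<in> {x..y}"
      then have "(f has_real_derivative f' z) (at z within {x..y})"
        using that by (intro DERIV_subset[OF f]) auto
      then show "(f has_vector_derivative f' z) (at z within {x..y})"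
        by (simp add: has_real_derivative_iff_has_vector_derivative)
    qed
    then have eq: "integral {x..y} f' = f y - f x" and f'_int: "f' integrable_on {x..y}"
      by (auto intro: integral_unique)
    have absint: "(\<lambda>x. \<bar>f' x\<bar>) integrable_on {a..b}" "(\<lambda>x. \<bar>f' x\<bar>) integrable_on {x..y}"
      using that cont by (auto intro!: integrable_continuous_interval continuous_intros
          intro: continuous_on_subset)
    have "\<bar>f y - f x\<bar> \<le> integral {x..y} (\<lambda>x. \<bar>f' x\<bar>)"
      using integral_norm_bound_integral[OF f'_int absint(2)] eq by simp
    also have "\<dots> \<le> integral {a..b} (\<lambda>x. \<bar>f' x\<bar>)"
      using that absint by (intro integral_subset_le) auto
    finally show "f y - f x \<le> integral {a..b} (\<lambda>x. \<bar>f' x\<bar>)" "f x - f y \<le> integral {a..b} (\<lambda>x. \<bar>f' x\<bar>)"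
      by auto
  qed
  have "f t - f s \<le> integral {a..b} (\<lambda>x. \<bar>f' x\<bar>)"
    using sub[OF s(1) t] sub[OF t s(1)] by (cases "s \<le> t") auto
  moreover have "f s \<le> integral {a..b} f / (b - a)"
    using s(2) \<open>a < b\<close> by (simp add: pos_le_divide_eq)
  ultimately show ?thesis by simp
qed

text \<open>
  The factor \<open>4 / R\<close> comes from choosing \<open>s\<close> in an interval of length \<open>R\<close> such that the sum of the
  four side integrals is at most its mean; each of the four integrates to at most the integral over
  the shell.
\<close>

lemma exists_square_with_small_values:
  fixes w :: "real^2 \<Rightarrow> real"
  defines "Q R \<equiv> {x::real^2. R \<le> infnorm x \<and> infnorm x \<le> 2 * R}"
  assumes "0 < R" and w: "C1_on \<Omega> w" and sub: "Q R \<subseteq> \<Omega>"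
    and nn: "\<And>x. x \<in> Q R \<Longrightarrow> 0 \<le> w x"
  shows "\<exists>s\<in>{R..2*R}. \<forall>x. infnorm x = s \<longrightarrow>
    w x \<le> 4 / R * (LINT x:Q R|lborel. w x / R + (\<Sum>j\<in>UNIV. \<bar>partial_deriv j w x\<bar>))"
proof -
  define h where "h = (\<lambda>x. w x / R + (\<Sum>j\<in>UNIV. \<bar>partial_deriv j w x\<bar>))"
  let ?I = "LINT x:Q R|lborel. h x"
  have cw: "continuous_on (Q R) w" and cd: "\<And>j. continuous_on (Q R) (partial_deriv j w)"
    using C1_onD[OF w] sub by (blast intro: continuous_on_subset)+
  have h_cont: "continuous_on (Q R) h"
    unfolding h_def by (intro continuous_intros cw cd) (use \<open>0 < R\<close> in auto)
  have h_nn: "0 \<le> h x" if "x \<in> Q R" for x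
    unfolding h_def using nn[OF that] \<open>0 < R\<close> by (auto intro!: add_nonneg_nonneg sum_nonneg)
  define J where "J = (\<lambda>i \<sigma> s. integral {-2*R..2*R} (\<lambda>y. h (side_point i \<sigma> s y)))"
  have J: "continuous_on {R..2*R} (J i \<sigma>)" "integral {R..2*R} (J i \<sigma>) \<le> ?I" if "\<sigma> = 1 \<or> \<sigma> = -1" for i \<sigma>
    using integral_side_le[OF that \<open>0 < R\<close> h_cont[unfolded Q_def] h_nn[unfolded Q_def]]
    unfolding J_def Q_def by blast+
  have Jint: "J i \<sigma> integrable_on {R..2*R}" if "\<sigma> = 1 \<or> \<sigma> = -1" for i \<sigma>
    by (rule integrable_continuous_interval[OF J(1)[OF that]])
  \<comment> \<open>One \<open>s\<close> has to serve all four sides, so their integrals are averaged together.\<close>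
  define F where "F = (\<lambda>s. (J 1 1 s + J 1 (-1) s) + (J 2 1 s + J 2 (-1) s))"
  have "continuous_on {R..2*R} F"
    unfolding F_def by (intro continuous_intros J) auto
  then obtain s where s: "s \<in> {R..2*R}" "F s * (2 * R - R) \<le> integral {R..2*R} F"
    using exists_le_integral_mean[of R "2*R" F] \<open>0 < R\<close> by auto
  have "integral {R..2*R} F = (integral {R..2*R} (J 1 1) + integral {R..2*R} (J 1 (-1)))
      + (integral {R..2*R} (J 2 1) + integral {R..2*R} (J 2 (-1)))"
    unfolding F_def by (subst integral_add; (intro integrable_add Jint; simp)?)+ simp
  also have "\<dots> \<le> 4 * ?I"
    using J(2)[of 1 1] J(2)[of "-1" 1] J(2)[of 1 2] J(2)[of "-1" 2] by simp
  finally have "F s \<le> 4 / R * ?I"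
    using s(2) \<open>0 < R\<close> by (simp add: field_simps)
  have side: "side_point i \<sigma> s y \<in> Q R" if "\<sigma> = 1 \<or> \<sigma> = -1" "y \<in> {-2*R..2*R}" for i \<sigma> y
    using that s(1) exhaust_2[of i] \<open>0 < R\<close> by (auto simp: Q_def infnorm_2 side_point_nth)
  have cside: "continuous_on {-2*R..2*R} (\<lambda>y. g (side_point i \<sigma> s y))"
    if "continuous_on (Q R) g" "\<sigma> = 1 \<or> \<sigma> = -1" for i \<sigma> and g :: "real^2 \<Rightarrow> real"
  proof (rule continuous_on_compose2[OF that(1)])
    show "continuous_on {-2*R..2*R} (side_point i \<sigma> s)"
      unfolding side_point_def by (intro continuous_intros)
  qed (use side that(2) in auto)
  have J_nn: "0 \<le> J i \<sigma> s" if "\<sigma> = 1 \<or> \<sigma> = -1" for i \<sigma>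
    unfolding J_def
    by (rule integral_nonneg[OF integrable_continuous_interval[OF cside[OF h_cont that]]])
      (use h_nn side that in auto)
  have w_le: "w (side_point i \<sigma> s y) \<le> J i \<sigma> s" if \<sigma>: "\<sigma> = 1 \<or> \<sigma> = -1" and y: "y \<in> {-2*R..2*R}" for i \<sigma> y
  proof -
    let ?k = "if i = 1 then 2 else 1 :: 2"
    have c: "continuous_on {-2*R..2*R} (\<lambda>y. w (side_point i \<sigma> s y) / (4*R))"
      by (intro continuous_intros cside[OF cw \<sigma>]) (use \<open>0 < R\<close> in auto)
    have c': "continuous_on {-2*R..2*R} (\<lambda>y. \<bar>partial_deriv ?k w (side_point i \<sigma> s y)\<bar>)"
      by (intro continuous_intros cside[OF cd \<sigma>])
    have "w (side_point i \<sigma> s y) \<le> integral {-2*R..2*R} (\<lambda>y. w (side_point i \<sigma> s y)) / (2*R - (-2*R))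
        + integral {-2*R..2*R} (\<lambda>y. \<bar>partial_deriv ?k w (side_point i \<sigma> s y)\<bar>)"
    proof (rule le_mean_plus_variation[OF _ _ _ y])
      fix t assume "t \<in> {-2*R..2*R}"
      then have "w differentiable (at (side_point i \<sigma> s t))"
        using side[OF \<sigma>] sub C1_onD(1)[OF w] by blast
      then show "((\<lambda>y. w (side_point i \<sigma> s y)) has_real_derivative
          partial_deriv ?k w (side_point i \<sigma> s t)) (at t within {-2*R..2*R})"
        unfolding side_point_def by (rule has_real_derivative_along_axis)
    qed (use \<open>0 < R\<close> cside[OF cd \<sigma>] in auto)
    also have "\<dots> = integral {-2*R..2*R} (\<lambda>y. w (side_point i \<sigma> s y) / (4*R)
        + \<bar>partial_deriv ?k w (side_point i \<sigma> s y)\<bar>)"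
      by (subst integral_add[OF integrable_continuous_interval[OF c] integrable_continuous_interval[OF c']])
        (simp add: integral_divide)
    also have "\<dots> \<le> J i \<sigma> s"
      unfolding J_def
    proof (rule integral_le)
      fix y assume "y \<in> {-2*R..2*R}"
      then have "0 \<le> w (side_point i \<sigma> s y)" using nn side[OF \<sigma>] by blast
      then have "w (side_point i \<sigma> s y) / (4*R) \<le> w (side_point i \<sigma> s y) / R"
        using \<open>0 < R\<close> by (intro divide_left_mono) auto
      moreover have "\<bar>partial_deriv ?k w (side_point i \<sigma> s y)\<bar>
          \<le> (\<Sum>j\<in>UNIV. \<bar>partial_deriv j w (side_point i \<sigma> s y)\<bar>)"
        by (rule member_le_sum) auto
      ultimately show "w (side_point i \<sigma> s y) / (4*R) + \<bar>partial_deriv ?k w (side_point i \<sigma> s y)\<bar>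
          \<le> h (side_point i \<sigma> s y)"
        unfolding h_def by simp
    qed (rule integrable_continuous_interval[OF continuous_on_add[OF c c']]
        integrable_continuous_interval[OF cside[OF h_cont \<sigma>]])+
    finally show ?thesis .
  qed
  have "w x \<le> F s" if inf: "infnorm x = s" for x
  proof -
    have s': "0 < s" "s \<le> 2 * R" using s(1) \<open>0 < R\<close> by auto
    obtain i \<sigma> y where x: "\<sigma> = 1 \<or> \<sigma> = -1" "y \<in> {-2*R..2*R}" "x = side_point i \<sigma> s y"
    proof (cases "\<bar>x $ 1\<bar> = s")
      case True
      then have "x = side_point 1 (if x $ 1 < 0 then -1 else 1) s (x $ 2)"
        by (auto simp: vec_eq_iff forall_2 side_point_nth)
      moreover have "x $ 2 \<in> {-2*R..2*R}" using inf s' by (auto simp: infnorm_2)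
      ultimately show thesis by (intro that[of "if x $ 1 < 0 then -1 else 1"]) auto
    next
      case False
      then have "\<bar>x $ 2\<bar> = s" "\<bar>x $ 1\<bar> \<le> s" using inf by (auto simp: infnorm_2 max_def split: if_splits)
      then have "x = side_point 2 (if x $ 2 < 0 then -1 else 1) s (x $ 1)" "x $ 1 \<in> {-2*R..2*R}"
        using s' by (auto simp: vec_eq_iff forall_2 side_point_nth)
      then show thesis by (intro that[of "if x $ 2 < 0 then -1 else 1"]) auto
    qed
    have "J i \<sigma> s \<le> F s"
      unfolding F_def using x(1) exhaust_2[of i] J_nn[of 1 1] J_nn[of "-1" 1] J_nn[of 1 2] J_nn[of "-1" 2]
      by auto
    then show ?thesis
      using w_le[OF x(1,2), of i] unfolding x(3) by linarith
  qed
  with s(1) \<open>F s \<le> 4 / R * ?I\<close> show ?thesis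
    unfolding h_def by (meson order_trans)
qed

section \<open>Powers of the solution\<close>

text \<open>
  This is \<open>|t|\<^bsup>q-2\<^esup>\<close>, with the continuous value 1 at \<open>t = 0\<close> when \<open>q = 2\<close>; there
  \<open>0 powr 0\<close> would give 0.
\<close>

definition power_weight :: "real \<Rightarrow> real \<Rightarrow> real"
  where "power_weight q t = (if q = 2 then 1 else \<bar>t\<bar> powr (q - 2))"

lemma power_weight_nonneg: "0 \<le> power_weight q t"
  by (simp add: power_weight_def)

lemma powr_eq_power_weight: "2 \<le> q \<Longrightarrow> \<bar>t\<bar> powr q = t\<^sup>2 * power_weight q t"
  by (cases "t = 0") (auto simp: power_weight_def powr_diff powr_realpow[of "\<bar>t\<bar>" 2, simplified])

lemma continuous_power_weight: "2 \<le> q \<Longrightarrow> continuous_on UNIV (power_weight q)"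
  unfolding power_weight_def by (cases "q = 2") (auto intro!: continuous_intros continuous_on_powr')

lemma has_real_derivative_odd_power:
  assumes "0 < p"
  shows "((\<lambda>t. t * \<bar>t\<bar> powr p) has_real_derivative (p + 1) * \<bar>t\<bar> powr p) (at t)"
proof -
  consider "0 < t" | "t < 0" | "t = 0" by linarith
  then show ?thesis
  proof cases
    case 1
    then have "((\<lambda>t. t * t powr p) has_real_derivative (p + 1) * \<bar>t\<bar> powr p) (at t)"
      by (auto intro!: derivative_eq_intros simp: powr_diff field_simps)
    then show ?thesis
      by (rule has_field_derivative_transform_within_open[of _ _ _ "{0<..}"]) (use 1 in auto)
  next
    case 2
    then have "((\<lambda>t. t * (- t) powr p) has_real_derivative (p + 1) * \<bar>t\<bar> powr p) (at t)"
      by (auto intro!: derivative_eq_intros simp: powr_diff field_simps)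
    then show ?thesis
      by (rule has_field_derivative_transform_within_open[of _ _ _ "{..<0}"]) (use 2 in auto)
  next
    case 3
    have "((\<lambda>h. \<bar>h\<bar> powr p) \<longlongrightarrow> \<bar>0::real\<bar> powr p) (at 0)"
      by (intro tendsto_intros) (use assms in auto)
    moreover have "\<forall>\<^sub>F h in at 0. \<bar>h::real\<bar> powr p = (h * \<bar>h\<bar> powr p) / h"
      by (auto simp: eventually_at_filter)
    ultimately have "((\<lambda>h. (h * \<bar>h\<bar> powr p) / h) \<longlongrightarrow> 0) (at (0::real))"
      by (auto intro: Lim_transform_eventually)
    then show ?thesis using 3 by (simp add: DERIV_def)
  qed
qed

lemma has_real_derivative_mult_power_weight:
  assumes "2 \<le> q"
  shows "((\<lambda>t. t * power_weight q t) has_real_derivative (q - 1) * power_weight q t) (at t)"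
  using has_real_derivative_odd_power[of "q - 2" t] assms
  by (cases "q = 2") (simp_all add: power_weight_def)

lemma has_real_derivative_abs_powr:
  assumes "2 \<le> q"
  shows "((\<lambda>t. \<bar>t\<bar> powr q) has_real_derivative q * (t * power_weight q t)) (at t)"
proof -
  have "((\<lambda>t. t * (t * power_weight q t)) has_real_derivative q * (t * power_weight q t)) (at t)"
    by (rule derivative_eq_intros has_real_derivative_mult_power_weight assms refl)+ (simp add: algebra_simps)
  then show ?thesis
    by (simp add: powr_eq_power_weight[OF assms] power2_eq_square mult.assoc)
qed

lemma C1_on_abs_powr:
  assumes u: "C1_on \<Omega> u" and "2 \<le> q"
  shows "C1_on \<Omega> (\<lambda>x. \<bar>u x\<bar> powr q)"
    and "x \<in> \<Omega> \<Longrightarrow> partial_deriv i (\<lambda>x. \<bar>u x\<bar> powr q) x = q * (u x * power_weight q (u x)) * partial_deriv i u x"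
proof -
  show "C1_on \<Omega> (\<lambda>x. \<bar>u x\<bar> powr q)"
    by (rule C1_on_compose[OF u has_real_derivative_abs_powr[OF \<open>2 \<le> q\<close>]])
      (intro continuous_intros continuous_power_weight \<open>2 \<le> q\<close>)
  show "x \<in> \<Omega> \<Longrightarrow> partial_deriv i (\<lambda>x. \<bar>u x\<bar> powr q) x = q * (u x * power_weight q (u x)) * partial_deriv i u x"
    by (rule partial_deriv_compose[OF C1_onD(1)[OF u] has_real_derivative_abs_powr[OF \<open>2 \<le> q\<close>]])
qed

lemma norm_gradient_sq: "(norm (grad u x))\<^sup>2 = (\<Sum>j\<in>UNIV. (partial_deriv j u x)\<^sup>2)"
  unfolding power2_norm_eq_inner inner_vec_def grad_def by (simp add: power2_eq_square)

lemma continuous_on_weighted_gradient: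
  assumes u: "C1_on \<Omega> u" and "T \<subseteq> \<Omega>" "2 \<le> q"
  shows "continuous_on T (\<lambda>x. power_weight q (u x) * (norm (grad u x))\<^sup>2)"
proof -
  have cu: "continuous_on T u" and cdu: "continuous_on T (partial_deriv j u)" for j
    using \<open>T \<subseteq> \<Omega>\<close>
    by (rule continuous_on_subset[OF C1_onD(3)[OF u]] continuous_on_subset[OF C1_onD(2)[OF u]])+
  have "continuous_on T (\<lambda>x. power_weight q (u x))"
    by (rule continuous_on_compose2[OF continuous_power_weight[OF \<open>2 \<le> q\<close>] cu]) simp
  then show ?thesis
    unfolding grad_def by (intro continuous_on_mult continuous_on_power continuous_on_norm
        continuous_on_vec_lambda cdu)
qed

section \<open>Annuli and cutoff functions\<close>

text \<open>
  The bounds \<open>\<rho>\<close> and \<open>\<sigma>\<close> refer to the squared relative radius, the variable in which the cutoff is a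
  polynomial.
\<close>

definition annulus :: "real \<Rightarrow> real \<Rightarrow> real \<Rightarrow> (real^2) set"
  where "annulus \<rho> \<sigma> R = {x. \<rho> \<le> x \<bullet> x / R\<^sup>2 \<and> x \<bullet> x / R\<^sup>2 \<le> \<sigma>}"

lemma annulus_mono: "\<rho>' \<le> \<rho> \<Longrightarrow> \<sigma> \<le> \<sigma>' \<Longrightarrow> annulus \<rho> \<sigma> R \<subseteq> annulus \<rho>' \<sigma>' R"
  unfolding annulus_def by (auto intro: order_trans)

lemma compact_annulus:
  assumes "0 < R"
  shows "compact (annulus \<rho> \<sigma> R)"
proof -
  have "closed (annulus \<rho> \<sigma> R)"
    unfolding annulus_def divide_inverse
    by (intro closed_Collect_conj closed_Collect_le continuous_intros)
  moreover have "bounded (annulus \<rho> \<sigma> R)"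
  proof (rule boundedI)
    fix x assume "x \<in> annulus \<rho> \<sigma> R"
    then have "(norm x)\<^sup>2 \<le> \<sigma> * R\<^sup>2"
      using assms by (simp add: annulus_def pos_divide_le_eq power2_norm_eq_inner)
    then show "norm x \<le> sqrt (\<sigma> * R\<^sup>2)" by (rule real_le_rsqrt)
  qed
  ultimately show ?thesis by (simp add: compact_eq_bounded_closed)
qed

lemma norm_bounds_of_annulus:
  assumes "0 < R" "x \<in> annulus (1/2) 9 R"
  shows "R / 2 \<le> norm x" "norm x \<le> 3 * R"
proof -
  have x: "R\<^sup>2 \<le> 2 * (norm x)\<^sup>2" "(norm x)\<^sup>2 \<le> 9 * R\<^sup>2"
    using assms by (simp_all add: annulus_def power2_norm_eq_inner pos_le_divide_eq pos_divide_le_eq)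
  have "R\<^sup>2 \<le> 4 * (norm x)\<^sup>2" using x(1) zero_le_power2[of "norm x"] by linarith
  then have "(R / 2)\<^sup>2 \<le> (norm x)\<^sup>2" by (simp add: power_divide)
  then show "R / 2 \<le> norm x" by (rule power2_le_imp_le) simp
  have "(norm x)\<^sup>2 \<le> (3 * R)\<^sup>2" using x(2) by (simp add: power_mult_distrib)
  then show "norm x \<le> 3 * R" by (rule power2_le_imp_le) (use assms in simp)
qed

text \<open>
  The upper bound 8 is \<open>(2 \<surd>2)\<^sup>2\<close>: the corners of the largest square are at distance \<open>2 \<surd>2 R\<close>.
\<close>

lemma square_annulus_subset_annulus:
  assumes "0 < R"
  shows "{x::real^2. R \<le> infnorm x \<and> infnorm x \<le> 2 * R} \<subseteq> annulus 1 8 R"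
proof safe
  fix x :: "real^2" assume x: "R \<le> infnorm x" "infnorm x \<le> 2 * R"
  have "R\<^sup>2 \<le> (norm x)\<^sup>2"
    using x(1) infnorm_le_norm[of x] assms by (intro power_mono) auto
  moreover have "(norm x)\<^sup>2 \<le> (sqrt 2 * (2 * R))\<^sup>2"
  proof (rule power_mono)
    have "norm x \<le> sqrt 2 * infnorm x" using norm_le_infnorm[of x] by simp
    also have "\<dots> \<le> sqrt 2 * (2 * R)" using x(2) by simp
    finally show "norm x \<le> sqrt 2 * (2 * R)" .
  qed simp
  ultimately show "x \<in> annulus 1 8 R"
    using assms by (simp add: annulus_def power2_norm_eq_inner pos_le_divide_eq pos_divide_le_eq power_mult_distrib)
qed

lemma C1_on_inner_self:
  "C1_on UNIV (\<lambda>x::real^'n::finite. x \<bullet> x)" "partial_deriv i (\<lambda>x::real^'n::finite. x \<bullet> x) x = 2 * x $ i"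
proof -
  have der: "((\<lambda>x::real^'n. x \<bullet> x) has_derivative (\<lambda>h. 2 * (x \<bullet> h))) (at x)" for x
    by (auto intro!: derivative_eq_intros simp: inner_commute)
  have pd: "partial_deriv i (\<lambda>x::real^'n. x \<bullet> x) x = 2 * x $ i" for i x
    using partial_deriv_eq[OF der] by (simp add: inner_axis)
  then show "partial_deriv i (\<lambda>x::real^'n. x \<bullet> x) x = 2 * x $ i" .
  have "partial_deriv i (\<lambda>x::real^'n. x \<bullet> x) = (\<lambda>x. 2 * x $ i)" for i
    by (rule ext) (rule pd)
  then show "C1_on UNIV (\<lambda>x::real^'n. x \<bullet> x)"
    using der by (auto simp: C1_on_def differentiable_def intro!: continuous_intros)
qed

lemma has_real_derivative_max_0_squared:
  "((\<lambda>t::real. (max 0 t)\<^sup>2) has_real_derivative 2 * max 0 t) (at t)"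
proof -
  \<comment> \<open>The square of the positive part is the mean of \<open>t\<^sup>2\<close> and \<open>t |t|\<close>.\<close>
  have "((\<lambda>t::real. (t * t + t * \<bar>t\<bar> powr 1) / 2) has_real_derivative (2 * t + 2 * \<bar>t\<bar> powr 1) / 2) (at t)"
    by (rule derivative_eq_intros has_real_derivative_odd_power refl)+ auto
  moreover have "(\<lambda>t::real. (t * t + t * \<bar>t\<bar> powr 1) / 2) = (\<lambda>t. (max 0 t)\<^sup>2)"
    by (auto simp: fun_eq_iff max_def power2_eq_square)
  moreover have "(2 * t + 2 * \<bar>t\<bar> powr 1) / 2 = 2 * max 0 t"
    by (auto simp: max_def)
  ultimately show ?thesis by simp
qed

text \<open>
  The cutoff is \<open>bump\<^sup>2\<close> of the squared relative radius.  Squaring makes it continuously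
  differentiable, and its gradient contains a factor \<open>bump\<close>, which the energy estimate needs to
  absorb the mixed term.
\<close>

definition bump :: "real \<Rightarrow> real"
  where "bump t = max 0 ((t - 1/2) * (9 - t))"

lemma bump_bounds:
  "0 \<le> bump t" "bump t \<le> 19" "1 \<le> t \<Longrightarrow> t \<le> 8 \<Longrightarrow> 1 \<le> bump t" "bump t \<noteq> 0 \<Longrightarrow> 1/2 \<le> t \<and> t \<le> 9"
proof -
  show "0 \<le> bump t" by (simp add: bump_def)
  have "(t - 1/2) * (9 - t) = 289/16 - (t - 19/4)\<^sup>2" by (simp add: power2_eq_square algebra_simps)
  then show "bump t \<le> 19" using zero_le_power2[of "t - 19/4"]
    unfolding bump_def by linarith
  show "1 \<le> bump t" if "1 \<le> t" "t \<le> 8"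
  proof -
    have "0 \<le> (t - 1) * (8 - t)" using that by simp
    then have "1 \<le> (t - 1/2) * (9 - t)" using that by (simp add: algebra_simps)
    then show ?thesis unfolding bump_def by (rule max.coboundedI2)
  qed
  show "1/2 \<le> t \<and> t \<le> 9" if "bump t \<noteq> 0"
  proof -
    have "0 < (t - 1/2) * (9 - t)"
    proof (rule ccontr)
      assume "\<not> 0 < (t - 1/2) * (9 - t)"
      then have "bump t = 0" unfolding bump_def by (intro max_absorb1) linarith
      with that show False by simp
    qed
    then show ?thesis by (auto simp: zero_less_mult_iff)
  qed
qed

lemma C1_on_cutoff:
  "C1_on UNIV (\<lambda>x::real^'n::finite. (bump (x \<bullet> x / R\<^sup>2))\<^sup>2)"
  "partial_deriv i (\<lambda>x::real^'n::finite. (bump (x \<bullet> x / R\<^sup>2))\<^sup>2) x =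
    2 * bump (x \<bullet> x / R\<^sup>2) * ((19/2 - 2 * (x \<bullet> x / R\<^sup>2)) * (2 * x $ i / R\<^sup>2))"
proof -
  define g' where "g' = (\<lambda>t. 2 * bump (t / R\<^sup>2) * ((19/2 - 2 * (t / R\<^sup>2)) * (1 / R\<^sup>2)))"
  have "((\<lambda>t. (t * k - 1/2) * (9 - t * k)) has_real_derivative (19/2 - 2 * (t * k)) * k) (at t)" for t k :: real
    by (auto intro!: derivative_eq_intros simp: algebra_simps)
  from this[of "1 / R\<^sup>2"]
  have "((\<lambda>t. (t / R\<^sup>2 - 1/2) * (9 - t / R\<^sup>2)) has_real_derivative
      (19/2 - 2 * (t / R\<^sup>2)) * (1 / R\<^sup>2)) (at t)" for t
    by (simp only: times_divide_eq_right mult_1_right)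
  from DERIV_chain2[OF has_real_derivative_max_0_squared this]
  have der: "((\<lambda>t. (bump (t / R\<^sup>2))\<^sup>2) has_real_derivative g' t) (at t)" for t
    unfolding bump_def g'_def .
  have cont: "continuous_on UNIV g'"
    unfolding g'_def bump_def divide_inverse by (intro continuous_intros)
  show "C1_on UNIV (\<lambda>x::real^'n. (bump (x \<bullet> x / R\<^sup>2))\<^sup>2)"
    by (rule C1_on_compose[OF C1_on_inner_self(1) der cont])
  show "partial_deriv i (\<lambda>x::real^'n. (bump (x \<bullet> x / R\<^sup>2))\<^sup>2) x =
    2 * bump (x \<bullet> x / R\<^sup>2) * ((19/2 - 2 * (x \<bullet> x / R\<^sup>2)) * (2 * x $ i / R\<^sup>2))"
    unfolding partial_deriv_compose[OF C1_onD(1)[OF C1_on_inner_self(1) UNIV_I] der] C1_on_inner_self(2) g'_def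
    by (simp only: mult.assoc times_divide_eq_left mult_1)
qed

section \<open>The energy estimate\<close>

text \<open>
  Here \<open>D\<close> stands for the gradient of \<open>u\<close>, \<open>U\<close> for \<open>u\<close>, \<open>m\<close> for \<open>|u|\<^bsup>q-2\<^esup>\<close>, \<open>e\<^sup>2\<close> for the cutoff and
  \<open>2 e \<nu>\<close> for its gradient; \<open>\<beta>\<close>, \<open>\<gamma>\<close>, \<open>\<delta>\<close> are the values of \<open>b\<close>, \<open>c\<close> and \<open>div b\<close>.  Positivity of the form
  \<open>A\<close> at \<open>e D + 2 U \<nu>\<close> bounds the mixed term by half of the energy and a multiple of \<open>U\<^sup>2\<close>.  The
  constant 26000 bounds the sum of \<open>23328\<close> from the mixed term and, since \<open>q \<ge> 2\<close>, half of
  \<open>361 + 4104\<close> from the terms with \<open>\<delta>\<close> and \<open>\<beta>\<close>.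
\<close>

lemma caccioppoli_pointwise:
  fixes A :: "2 \<Rightarrow> 2 \<Rightarrow> real" and D \<nu> \<beta> :: "real^2"
  assumes sym: "\<And>i j. A i j = A j i"
    and "0 < l" and ell: "\<And>v::real^2. l * (norm v)\<^sup>2 \<le> (\<Sum>i\<in>UNIV. \<Sum>j\<in>UNIV. A i j * v $ i * v $ j)"
    and "2 \<le> q" "0 \<le> m" "0 \<le> e" "e \<le> 19" "0 < R"
    and A: "\<And>i j. \<bar>A i j\<bar> \<le> K * R\<^sup>2" and \<nu>: "\<And>i. \<bar>\<nu> $ i\<bar> \<le> 54 / R"
    and \<beta>: "\<And>i. \<bar>\<beta> $ i\<bar> \<le> K * R" and "0 \<le> \<gamma>" and \<delta>: "\<delta> \<le> 2 * \<gamma> + K"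
  shows "q * (l / 2) * (e\<^sup>2 * m * (norm D)\<^sup>2)
    \<le> q * (q - 1) * e\<^sup>2 * m * (\<Sum>i\<in>UNIV. \<Sum>j\<in>UNIV. A i j * D $ i * D $ j)
      + 2 * q * m * e * U * (\<Sum>i\<in>UNIV. \<Sum>j\<in>UNIV. A i j * \<nu> $ i * D $ j)
      + e\<^sup>2 * U\<^sup>2 * m * (q * \<gamma> - \<delta>) - 2 * e * U\<^sup>2 * m * (\<Sum>i\<in>UNIV. \<nu> $ i * \<beta> $ i)
      + 26000 * q * K * (U\<^sup>2 * m)"
proof -
  define Q where "Q = (\<lambda>v w::real^2. \<Sum>i\<in>UNIV. \<Sum>j\<in>UNIV. A i j * v $ i * w $ j)"
  have s: "A 2 1 = A 1 2" by (rule sym)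
  have "0 \<le> K"
    using A[of 1 1] \<open>0 < R\<close> by (smt (verit) abs_ge_zero mult_neg_pos zero_less_power)
  have QD: "l * (norm D)\<^sup>2 \<le> Q D D" unfolding Q_def by (rule ell)
  then have "0 \<le> Q D D" using \<open>0 < l\<close> by (smt (verit) mult_nonneg_nonneg zero_le_power2)
  have Q\<nu>: "Q \<nu> \<nu> \<le> 11664 * K"
  proof -
    have "A i j * \<nu> $ i * \<nu> $ j \<le> (K * R\<^sup>2) * (54 / R) * (54 / R)" for i j
    proof -
      have "\<bar>A i j * \<nu> $ i * \<nu> $ j\<bar> \<le> (K * R\<^sup>2) * (54 / R) * (54 / R)"
        unfolding abs_mult using A \<nu> \<open>0 \<le> K\<close> \<open>0 < R\<close> by (intro mult_mono mult_nonneg_nonneg) auto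
      then show ?thesis by linarith
    qed
    moreover have "(K * R\<^sup>2) * (54 / R) * (54 / R) = 2916 * K"
      using \<open>0 < R\<close> by (simp add: power2_eq_square)
    ultimately have "A i j * \<nu> $ i * \<nu> $ j \<le> 2916 * K" for i j by simp
    from this[of 1 1] this[of 1 2] this[of 2 1] this[of 2 2] show ?thesis
      by (simp add: Q_def sum_2)
  qed
  have "0 \<le> Q (e *\<^sub>R D + (2 * U) *\<^sub>R \<nu>) (e *\<^sub>R D + (2 * U) *\<^sub>R \<nu>)"
    using ell[of "e *\<^sub>R D + (2 * U) *\<^sub>R \<nu>"] \<open>0 < l\<close> unfolding Q_def
    by (smt (verit) mult_nonneg_nonneg zero_le_power2)
  also have "\<dots> = e\<^sup>2 * Q D D + 4 * e * U * Q \<nu> D + 4 * U\<^sup>2 * Q \<nu> \<nu>"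
    by (simp add: Q_def sum_2 s power2_eq_square algebra_simps)
  finally have *: "- (e\<^sup>2 * Q D D) / 2 - 2 * U\<^sup>2 * Q \<nu> \<nu> \<le> 2 * e * U * Q \<nu> D" by simp
  have qm: "0 \<le> q * m" using \<open>2 \<le> q\<close> \<open>0 \<le> m\<close> by simp
  have "l * (e\<^sup>2 * (norm D)\<^sup>2) / 2 - 23328 * K * U\<^sup>2 \<le> e\<^sup>2 * Q D D + 2 * e * U * Q \<nu> D"
  proof -
    have "e\<^sup>2 * (l * (norm D)\<^sup>2) \<le> e\<^sup>2 * Q D D" by (rule mult_left_mono[OF QD]) simp
    moreover have "U\<^sup>2 * Q \<nu> \<nu> \<le> U\<^sup>2 * (11664 * K)" by (rule mult_left_mono[OF Q\<nu>]) simp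
    ultimately show ?thesis using * by (simp add: algebra_simps)
  qed
  from mult_left_mono[OF this qm]
  have 1: "q * m * (l * (e\<^sup>2 * (norm D)\<^sup>2) / 2) - 23328 * q * K * (U\<^sup>2 * m)
      \<le> q * m * e\<^sup>2 * Q D D + 2 * q * m * e * U * Q \<nu> D"
    by (simp add: algebra_simps)
  have 2: "q * m * e\<^sup>2 * Q D D \<le> q * (q - 1) * e\<^sup>2 * m * Q D D"
  proof -
    have "(q * m * e\<^sup>2 * Q D D) * 1 \<le> (q * m * e\<^sup>2 * Q D D) * (q - 1)"
      using \<open>0 \<le> m\<close> \<open>0 \<le> Q D D\<close> \<open>2 \<le> q\<close> by (intro mult_left_mono mult_nonneg_nonneg) auto
    then show ?thesis by (simp add: mult_ac)
  qed
  have Um: "0 \<le> U\<^sup>2 * m" using \<open>0 \<le> m\<close> by simp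
  have 3: "- (361 * K) * (U\<^sup>2 * m) \<le> e\<^sup>2 * (q * \<gamma> - \<delta>) * (U\<^sup>2 * m)"
  proof (rule mult_right_mono[OF _ Um])
    have "2 * \<gamma> \<le> q * \<gamma>" using \<open>2 \<le> q\<close> \<open>0 \<le> \<gamma>\<close> by (rule mult_right_mono)
    then have "e\<^sup>2 * (- K) \<le> e\<^sup>2 * (q * \<gamma> - \<delta>)" using \<delta> by (intro mult_left_mono) auto
    moreover have "e\<^sup>2 \<le> 19\<^sup>2" using \<open>0 \<le> e\<close> \<open>e \<le> 19\<close> by (intro power_mono) auto
    then have "e\<^sup>2 * K \<le> 361 * K" using \<open>0 \<le> K\<close> by (intro mult_right_mono) auto
    ultimately show "- (361 * K) \<le> e\<^sup>2 * (q * \<gamma> - \<delta>)" by simp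
  qed
  have 4: "2 * e * (\<Sum>i\<in>UNIV. \<nu> $ i * \<beta> $ i) * (U\<^sup>2 * m) \<le> 4104 * K * (U\<^sup>2 * m)"
  proof (rule mult_right_mono[OF _ Um])
    have "\<nu> $ i * \<beta> $ i \<le> 54 * K" for i
    proof -
      have "\<bar>\<nu> $ i * \<beta> $ i\<bar> \<le> (54 / R) * (K * R)"
        unfolding abs_mult using \<nu> \<beta> \<open>0 < R\<close> by (intro mult_mono) auto
      also have "\<dots> = 54 * K" using \<open>0 < R\<close> by simp
      finally show ?thesis by linarith
    qed
    from this[of 1] this[of 2] have "(\<Sum>i\<in>UNIV. \<nu> $ i * \<beta> $ i) \<le> 108 * K"
      by (simp add: sum_2)
    then have "(2 * e) * (\<Sum>i\<in>UNIV. \<nu> $ i * \<beta> $ i) \<le> (2 * e) * (108 * K)"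
      using \<open>0 \<le> e\<close> by (intro mult_left_mono) auto
    also have "\<dots> \<le> (2 * 19) * (108 * K)"
      using \<open>e \<le> 19\<close> \<open>0 \<le> K\<close> by (intro mult_right_mono) auto
    finally show "2 * e * (\<Sum>i\<in>UNIV. \<nu> $ i * \<beta> $ i) \<le> 4104 * K" by simp
  qed
  have 5: "4465 * (K * (U\<^sup>2 * m)) \<le> (2672 * q) * (K * (U\<^sup>2 * m))"
    using \<open>2 \<le> q\<close> \<open>0 \<le> K\<close> Um by (intro mult_right_mono) auto
  show ?thesis
    using 1 2 3 4 5 unfolding Q_def by (simp add: algebra_simps)
qed

text \<open>
  The left-hand side is the divergence of the field \<open>V\<close> in the next proof, after the product rule;
  the hypothesis is the differential equation, with \<open>\<omega>\<close> the partial derivatives that make up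
  the divergence of \<open>A D\<close>.
\<close>

lemma caccioppoli_expansion:
  fixes A :: "2 \<Rightarrow> 2 \<Rightarrow> real" and D \<nu> \<beta> :: "real^2" and \<omega> d :: "2 \<Rightarrow> real"
  assumes "(\<Sum>i\<in>UNIV. \<omega> i) = \<beta> \<bullet> D + \<gamma> * U"
  shows "(\<Sum>i\<in>UNIV. (e\<^sup>2 * (q * (U * m)) * \<omega> i
        + (e\<^sup>2 * (q * ((q - 1) * m) * D $ i) + 2 * e * \<nu> $ i * (q * (U * m))) * (\<Sum>j\<in>UNIV. A i j * D $ j))
      - (e\<^sup>2 * (U\<^sup>2 * m) * d i + (e\<^sup>2 * (q * (U * m) * D $ i) + 2 * e * \<nu> $ i * (U\<^sup>2 * m)) * \<beta> $ i))
    = q * (q - 1) * e\<^sup>2 * m * (\<Sum>i\<in>UNIV. \<Sum>j\<in>UNIV. A i j * D $ i * D $ j)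
      + 2 * q * m * e * U * (\<Sum>i\<in>UNIV. \<Sum>j\<in>UNIV. A i j * \<nu> $ i * D $ j)
      + e\<^sup>2 * U\<^sup>2 * m * (q * \<gamma> - (\<Sum>i\<in>UNIV. d i)) - 2 * e * U\<^sup>2 * m * (\<Sum>i\<in>UNIV. \<nu> $ i * \<beta> $ i)"
proof -
  have w: "\<omega> 1 = \<beta> $ 1 * D $ 1 + \<beta> $ 2 * D $ 2 + \<gamma> * U - \<omega> 2"
    using assms by (simp add: sum_2 inner_vec_def)
  show ?thesis
    unfolding sum_2 w by (simp add: algebra_simps power2_eq_square)
qed

text \<open>
  Instead of testing the equation and integrating by parts, the divergence of
  \<open>V = \<eta> q |u|\<^bsup>q-2\<^esup> u a\<nabla>u - \<eta> |u|\<^sup>q b\<close> is estimated from below pointwise; its integral is 0.  The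
  term with \<open>c\<close>, an arbitrary nonnegative function, is thus dealt with before any integration.
  The conclusion is linear in \<open>K\<close>, which bounds all coefficients after rescaling to size 1.
\<close>

lemma caccioppoli:
  fixes u c :: "real^2 \<Rightarrow> real" and b :: "real^2 \<Rightarrow> real^2" and a :: "2 \<Rightarrow> 2 \<Rightarrow> real^2 \<Rightarrow> real"
  defines "S \<equiv> annulus (1/2) 9" and "T \<equiv> annulus 1 8"
  assumes "open \<Omega>" and a_C1: "\<And>i j. C1_on \<Omega> (a i j)" and b_C1: "\<And>i. C1_on \<Omega> (\<lambda>x. b x $ i)"
    and u_C2: "C2_on \<Omega> u"
    and sym: "\<And>i j x. x \<in> \<Omega> \<Longrightarrow> a i j x = a j i x"
    and "0 < l" and ell: "\<And>x v::real^2. x \<in> \<Omega> \<Longrightarrow>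
      l * (norm v)\<^sup>2 \<le> (\<Sum>i\<in>UNIV. \<Sum>j\<in>UNIV. a i j x * v $ i * v $ j)"
    and c_nonneg: "\<And>x. x \<in> \<Omega> \<Longrightarrow> 0 \<le> c x"
    and pde: "\<And>x. x \<in> \<Omega> \<Longrightarrow>
          - (\<Sum>i\<in>UNIV. \<Sum>j\<in>UNIV. partial_deriv i (\<lambda>y. a i j y * partial_deriv j u y) x)
            + b x \<bullet> grad u x + c x * u x = 0"
    and "2 \<le> q" "0 < R" and sub: "S R \<subseteq> \<Omega>"
    and a_le: "\<And>x i j. x \<in> S R \<Longrightarrow> \<bar>a i j x\<bar> \<le> K * R\<^sup>2"
    and b_le: "\<And>x. x \<in> S R \<Longrightarrow> norm (b x) \<le> K * R"
    and div_le: "\<And>x. x \<in> S R \<Longrightarrow> divergence b x \<le> 2 * c x + K"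
  shows "l * (LINT x:T R|lborel. power_weight q (u x) * (norm (grad u x))\<^sup>2)
    \<le> 52000 * K * (LINT x:S R|lborel. \<bar>u x\<bar> powr q)"
proof -
  let ?t = "\<lambda>x::real^2. x \<bullet> x / R\<^sup>2"
  let ?\<eta> = "\<lambda>x::real^2. (bump (?t x))\<^sup>2"
  let ?m = "\<lambda>x. power_weight q (u x)"
  define \<nu> where "\<nu> = (\<lambda>x. (\<chi> i. (19/2 - 2 * ?t x) * (2 * x $ i / R\<^sup>2)) :: real^2)"
  define g where "g = (\<lambda>t. q * (t * power_weight q t))"
  define W where "W = (\<lambda>i x. \<Sum>j\<in>UNIV. a i j x * partial_deriv j u x)"
  define V where "V = (\<lambda>i x. ?\<eta> x * g (u x) * W i x - ?\<eta> x * \<bar>u x\<bar> powr q * b x $ i)"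
  have compS: "compact (S R)" and compT: "compact (T R)"
    unfolding S_def T_def by (rule compact_annulus[OF \<open>0 < R\<close>])+
  have TS: "T R \<subseteq> S R" unfolding S_def T_def by (rule annulus_mono) auto
  have u_C1: "C1_on \<Omega> u" and du_C1: "\<And>j. C1_on \<Omega> (partial_deriv j u)"
    using u_C2 by (auto simp: C2_on_def)
  have g_der: "(g has_real_derivative q * ((q - 1) * power_weight q t)) (at t)" for t
    unfolding g_def by (intro DERIV_cmult has_real_derivative_mult_power_weight \<open>2 \<le> q\<close>)
  have G_der: "((\<lambda>t. \<bar>t\<bar> powr q) has_real_derivative g t) (at t)" for t
    unfolding g_def by (rule has_real_derivative_abs_powr[OF \<open>2 \<le> q\<close>])
  have g_cont: "continuous_on UNIV g"
    unfolding g_def by (intro continuous_intros continuous_power_weight \<open>2 \<le> q\<close>)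
  have \<eta>_C1: "C1_on \<Omega> ?\<eta>" by (rule C1_on_subset[OF C1_on_cutoff(1) subset_UNIV])
  have gu_C1: "C1_on \<Omega> (\<lambda>x. g (u x))"
    by (rule C1_on_compose[OF u_C1 g_der]) (intro continuous_intros continuous_power_weight \<open>2 \<le> q\<close>)
  have Gu_C1: "C1_on \<Omega> (\<lambda>x. \<bar>u x\<bar> powr q)"
    by (rule C1_on_compose[OF u_C1 G_der g_cont])
  have W_C1: "C1_on \<Omega> (W i)" for i
    unfolding W_def by (intro C1_on_sum C1_on_mult a_C1 du_C1) simp
  have V_C1: "C1_on \<Omega> (V i)" for i
    unfolding V_def by (intro C1_on_diff C1_on_mult \<eta>_C1 gu_C1 Gu_C1 W_C1 b_C1)
  have V_zero: "V i x = 0" if "x \<notin> S R" for i x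
  proof -
    have "bump (?t x) = 0" using that bump_bounds(4)[of "?t x"] by (auto simp: S_def annulus_def)
    then show ?thesis by (simp add: V_def)
  qed
  have ext: "C1_on UNIV (V i)" and dV_zero: "x \<notin> S R \<Longrightarrow> partial_deriv i (V i) x = 0" for i x
    using C1_on_zero_outside[OF \<open>open \<Omega>\<close> V_C1 compact_imp_closed[OF compS] sub] V_zero by blast+
  have int0: "integrable lborel (partial_deriv i (V i))" "(\<integral>x. partial_deriv i (V i) x \<partial>lborel) = 0" for i
    using integral_partial_deriv_eq_0[OF ext compS] V_zero by blast+
  define dV where "dV = (\<lambda>x. \<Sum>i\<in>UNIV. partial_deriv i (V i) x)"
  have dV: "integrable lborel dV" "(\<integral>x. dV x \<partial>lborel) = 0"
    unfolding dV_def using int0 by auto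
  have contS: "continuous_on (S R) (\<lambda>x. \<bar>u x\<bar> powr q)"
    by (rule continuous_on_subset[OF C1_onD(3)[OF Gu_C1] sub])
  have contT: "continuous_on (T R) (\<lambda>x. ?m x * (norm (grad u x))\<^sup>2)"
    by (rule continuous_on_weighted_gradient[OF u_C1 _ \<open>2 \<le> q\<close>]) (use TS sub in blast)
  note intS = borel_integrable_compact[OF compS contS]
  note intT = borel_integrable_compact[OF compT contT]
  have pointwise: "q * (l / 2) * (?\<eta> x * ?m x * (norm (grad u x))\<^sup>2)
      \<le> dV x + 26000 * q * K * (\<bar>u x\<bar> powr q)" if x: "x \<in> S R" for x
  proof -
    have "x \<in> \<Omega>" using x sub by blast
    have diff: "f differentiable (at x)" if "C1_on \<Omega> f" for f
      using C1_onD(1)[OF that \<open>x \<in> \<Omega>\<close>] .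
    have G: "\<bar>u x\<bar> powr q = (u x)\<^sup>2 * ?m x" by (rule powr_eq_power_weight[OF \<open>2 \<le> q\<close>])
    have d\<eta>: "partial_deriv i ?\<eta> x = 2 * bump (?t x) * \<nu> x $ i" for i
      by (simp only: C1_on_cutoff(2) \<nu>_def vec_lambda_beta)
    have dgu: "partial_deriv i (\<lambda>y. g (u y)) x = q * ((q - 1) * ?m x) * partial_deriv i u x" for i
      by (rule partial_deriv_compose[OF diff[OF u_C1] g_der])
    have dGu: "partial_deriv i (\<lambda>y. \<bar>u y\<bar> powr q) x = g (u x) * partial_deriv i u x" for i
      by (rule partial_deriv_compose[OF diff[OF u_C1] G_der])
    have dg: "partial_deriv i (\<lambda>y. ?\<eta> y * g (u y)) x
        = ?\<eta> x * partial_deriv i (\<lambda>y. g (u y)) x + partial_deriv i ?\<eta> x * g (u x)" for i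
      by (rule partial_deriv_mult[OF diff[OF \<eta>_C1] diff[OF gu_C1]])
    have dG: "partial_deriv i (\<lambda>y. ?\<eta> y * \<bar>u y\<bar> powr q) x
        = ?\<eta> x * partial_deriv i (\<lambda>y. \<bar>u y\<bar> powr q) x + partial_deriv i ?\<eta> x * \<bar>u x\<bar> powr q" for i
      by (rule partial_deriv_mult[OF diff[OF \<eta>_C1] diff[OF Gu_C1]])
    have dgW: "partial_deriv i (\<lambda>y. ?\<eta> y * g (u y) * W i y) x
        = ?\<eta> x * g (u x) * partial_deriv i (W i) x + partial_deriv i (\<lambda>y. ?\<eta> y * g (u y)) x * W i x" for i
      by (rule partial_deriv_mult[OF diff[OF C1_on_mult[OF \<eta>_C1 gu_C1]] diff[OF W_C1]])
    have dGb: "partial_deriv i (\<lambda>y. ?\<eta> y * \<bar>u y\<bar> powr q * b y $ i) x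
        = ?\<eta> x * \<bar>u x\<bar> powr q * partial_deriv i (\<lambda>y. b y $ i) x
          + partial_deriv i (\<lambda>y. ?\<eta> y * \<bar>u y\<bar> powr q) x * b x $ i" for i
      by (rule partial_deriv_mult[OF diff[OF C1_on_mult[OF \<eta>_C1 Gu_C1]] diff[OF b_C1]])
    have dV_diff: "partial_deriv i (V i) x = partial_deriv i (\<lambda>y. ?\<eta> y * g (u y) * W i y) x
        - partial_deriv i (\<lambda>y. ?\<eta> y * \<bar>u y\<bar> powr q * b y $ i) x" for i
      unfolding V_def
      by (rule partial_deriv_diff[OF diff[OF C1_on_mult[OF C1_on_mult[OF \<eta>_C1 gu_C1] W_C1]]
            diff[OF C1_on_mult[OF C1_on_mult[OF \<eta>_C1 Gu_C1] b_C1]]])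
    have dVi: "partial_deriv i (V i) x
        = (?\<eta> x * g (u x) * partial_deriv i (W i) x
            + (?\<eta> x * (q * ((q - 1) * ?m x) * partial_deriv i u x) + 2 * bump (?t x) * \<nu> x $ i * g (u x)) * W i x)
          - (?\<eta> x * \<bar>u x\<bar> powr q * partial_deriv i (\<lambda>y. b y $ i) x
            + (?\<eta> x * (g (u x) * partial_deriv i u x) + 2 * bump (?t x) * \<nu> x $ i * \<bar>u x\<bar> powr q) * b x $ i)" for i
      by (simp only: dV_diff dgW dGb dg dG dgu dGu d\<eta>)
    have divW: "(\<Sum>i\<in>UNIV. partial_deriv i (W i) x) = b x \<bullet> grad u x + c x * u x"
    proof -
      have "partial_deriv i (W i) x = (\<Sum>j\<in>UNIV. partial_deriv i (\<lambda>y. a i j y * partial_deriv j u y) x)" for i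
        unfolding W_def by (rule partial_deriv_sum) (rule diff[OF C1_on_mult[OF a_C1 du_C1]])
      then show ?thesis using pde[OF \<open>x \<in> \<Omega>\<close>] by simp
    qed
    have t: "1/2 \<le> ?t x" "?t x \<le> 9" using x by (auto simp: S_def annulus_def)
    have \<nu>_le: "\<bar>\<nu> x $ i\<bar> \<le> 54 / R" for i
    proof -
      have "(norm x)\<^sup>2 \<le> (3 * R)\<^sup>2"
        using t(2) \<open>0 < R\<close> by (simp add: pos_divide_le_eq power2_norm_eq_inner power_mult_distrib)
      then have "norm x \<le> 3 * R" by (rule power2_le_imp_le) (use \<open>0 < R\<close> in simp)
      then have "\<bar>x $ i\<bar> \<le> 3 * R" using component_le_norm_cart[of x i] by linarith
      then have "\<bar>2 * x $ i / R\<^sup>2\<bar> \<le> 6 / R"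
        using \<open>0 < R\<close> by (simp add: abs_mult field_simps power2_eq_square)
      moreover have "\<bar>19/2 - 2 * ?t x\<bar> \<le> 9" using t by (simp add: abs_le_iff)
      ultimately have "\<bar>19/2 - 2 * ?t x\<bar> * \<bar>2 * x $ i / R\<^sup>2\<bar> \<le> 9 * (6 / R)"
        by (intro mult_mono) auto
      then show ?thesis by (simp add: \<nu>_def abs_mult)
    qed
    have b_i: "\<bar>b x $ i\<bar> \<le> K * R" for i
      using component_le_norm_cart[of "b x" i] b_le[OF x] by linarith
    have "q * (l / 2) * ((bump (?t x))\<^sup>2 * ?m x * (norm (grad u x))\<^sup>2)
      \<le> q * (q - 1) * (bump (?t x))\<^sup>2 * ?m x * (\<Sum>i\<in>UNIV. \<Sum>j\<in>UNIV. a i j x * grad u x $ i * grad u x $ j)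
      + 2 * q * ?m x * bump (?t x) * u x * (\<Sum>i\<in>UNIV. \<Sum>j\<in>UNIV. a i j x * \<nu> x $ i * grad u x $ j)
      + (bump (?t x))\<^sup>2 * (u x)\<^sup>2 * ?m x * (q * c x - divergence b x)
      - 2 * bump (?t x) * (u x)\<^sup>2 * ?m x * (\<Sum>i\<in>UNIV. \<nu> x $ i * b x $ i)
      + 26000 * q * K * ((u x)\<^sup>2 * ?m x)"
      using sym[OF \<open>x \<in> \<Omega>\<close>] \<open>0 < l\<close> ell[OF \<open>x \<in> \<Omega>\<close>] \<open>2 \<le> q\<close> power_weight_nonneg bump_bounds(1,2) \<open>0 < R\<close>
        a_le[OF x] \<nu>_le b_i c_nonneg[OF \<open>x \<in> \<Omega>\<close>] div_le[OF x]
      by (rule caccioppoli_pointwise)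
    note energy = this
    have gx: "g (u x) = q * (u x * ?m x)" by (simp only: g_def)
    have grad: "partial_deriv i u x = grad u x $ i" for i by (simp only: grad_def vec_lambda_beta)
    have Wx: "W i x = (\<Sum>j\<in>UNIV. a i j x * grad u x $ j)" for i by (simp only: W_def grad)
    note expansion = caccioppoli_expansion[where e = "bump (?t x)" and q = q and U = "u x" and m = "?m x"
        and \<nu> = "\<nu> x" and D = "grad u x" and \<beta> = "b x" and \<gamma> = "c x" and A = "\<lambda>i j. a i j x"
        and \<omega> = "\<lambda>i. partial_deriv i (W i) x" and d = "\<lambda>i. partial_deriv i (\<lambda>y. b y $ i) x", OF divW]
    have "dV x = (\<Sum>i\<in>UNIV. ((bump (?t x))\<^sup>2 * (q * (u x * ?m x)) * partial_deriv i (W i) x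
        + ((bump (?t x))\<^sup>2 * (q * ((q - 1) * ?m x) * grad u x $ i) + 2 * bump (?t x) * \<nu> x $ i * (q * (u x * ?m x)))
          * (\<Sum>j\<in>UNIV. a i j x * grad u x $ j))
      - ((bump (?t x))\<^sup>2 * ((u x)\<^sup>2 * ?m x) * partial_deriv i (\<lambda>y. b y $ i) x
        + ((bump (?t x))\<^sup>2 * (q * (u x * ?m x) * grad u x $ i) + 2 * bump (?t x) * \<nu> x $ i * ((u x)\<^sup>2 * ?m x)) * b x $ i))"
      unfolding dV_def dVi G gx Wx grad by (rule refl)
    note dVx = trans[OF this expansion]
    show ?thesis
      using energy unfolding dVx divergence_def G .
  qed
  have "q * (l / 2) * (indicator (T R) x * (?m x * (norm (grad u x))\<^sup>2))
      \<le> dV x + 26000 * q * K * (indicator (S R) x * \<bar>u x\<bar> powr q)" for x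
  proof (cases "x \<in> S R")
    case True
    have "indicator (T R) x * (?m x * (norm (grad u x))\<^sup>2) \<le> ?\<eta> x * (?m x * (norm (grad u x))\<^sup>2)"
    proof (rule mult_right_mono)
      show "indicator (T R) x \<le> ?\<eta> x"
        using bump_bounds(3)[of "?t x"] by (auto simp: T_def annulus_def indicator_def one_le_power)
    qed (simp add: power_weight_nonneg)
    then have "q * (l / 2) * (indicator (T R) x * (?m x * (norm (grad u x))\<^sup>2))
        \<le> q * (l / 2) * (?\<eta> x * (?m x * (norm (grad u x))\<^sup>2))"
      using \<open>0 < l\<close> \<open>2 \<le> q\<close> by (intro mult_left_mono) auto
    with pointwise[OF True] True show ?thesis by (simp add: mult.assoc)
  next
    case False
    then have "x \<notin> T R" using TS by blast
    then show ?thesis using False dV_zero[OF False] by (auto simp: dV_def)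
  qed
  then have "(\<integral>x. q * (l / 2) * (indicator (T R) x * (?m x * (norm (grad u x))\<^sup>2)) \<partial>lborel)
      \<le> (\<integral>x. dV x + 26000 * q * K * (indicator (S R) x * \<bar>u x\<bar> powr q) \<partial>lborel)"
    using intT intS dV(1) by (intro integral_mono) auto
  then have "q * (l / 2) * (LINT x:T R|lborel. ?m x * (norm (grad u x))\<^sup>2)
      \<le> 26000 * q * K * (LINT x:S R|lborel. \<bar>u x\<bar> powr q)"
    using intS dV by (simp add: set_lebesgue_integral_def)
  then have "q * (l * (LINT x:T R|lborel. ?m x * (norm (grad u x))\<^sup>2))
      \<le> q * (52000 * K * (LINT x:S R|lborel. \<bar>u x\<bar> powr q))"
    by (simp add: algebra_simps)
  then show ?thesis using \<open>2 \<le> q\<close> by simp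
qed

section \<open>Smallness on a square in each annulus\<close>

lemma set_integral_mono_subset:
  fixes f :: "'a::euclidean_space \<Rightarrow> real"
  assumes "compact B" "continuous_on B f" "compact A" "A \<subseteq> B" "\<And>x. x \<in> B \<Longrightarrow> 0 \<le> f x"
  shows "(LINT x:A|lborel. f x) \<le> (LINT x:B|lborel. f x)"
  unfolding set_lebesgue_integral_def
proof (rule integral_mono)
  show "integrable lborel (\<lambda>x. indicator A x *\<^sub>R f x)"
    using assms by (intro borel_integrable_compact) (auto intro: continuous_on_subset)
  show "integrable lborel (\<lambda>x. indicator B x *\<^sub>R f x)"
    using assms by (intro borel_integrable_compact)
  show "indicator A x *\<^sub>R f x \<le> indicator B x *\<^sub>R f x" for x
    using assms(4,5) by (auto simp: indicator_def)
qed

text \<open>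
  The number \<open>\<mu>\<close> balances the two parts of \<open>q |u|\<^bsup>q-1\<^esup> |\<nabla>u| \<le> q (\<mu> |u|\<^sup>q + |u|\<^bsup>q-2\<^esup> |\<nabla>u|\<^sup>2 / \<mu>)\<close>; the
  best choice for an energy \<open>E\<close> that is smaller than the integral of \<open>|u|\<^sup>q\<close> by a factor of
  order \<open>R\<^bsup>-\<gamma>\<^esup>\<close> is \<open>\<mu> = R\<^bsup>-\<gamma>/2\<^esup>\<close>.
\<close>

lemma exists_square_power_bound:
  fixes u :: "real^2 \<Rightarrow> real"
  defines "S \<equiv> annulus (1/2) 9" and "T \<equiv> annulus 1 8"
  assumes u: "C1_on \<Omega> u" and "2 \<le> q" "0 < R" and sub: "S R \<subseteq> \<Omega>" and "0 < \<mu>"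
    and energy: "(LINT x:T R|lborel. power_weight q (u x) * (norm (grad u x))\<^sup>2) \<le> E"
  shows "\<exists>s\<in>{R..2*R}. \<forall>x. infnorm x = s \<longrightarrow>
    \<bar>u x\<bar> powr q \<le> 4 / R * ((1 / R + q * \<mu>) * (LINT x:S R|lborel. \<bar>u x\<bar> powr q) + q / \<mu> * E)"
proof -
  let ?Q = "{x::real^2. R \<le> infnorm x \<and> infnorm x \<le> 2 * R}"
  let ?w = "\<lambda>x. \<bar>u x\<bar> powr q"
  let ?d = "\<lambda>x. power_weight q (u x) * (norm (grad u x))\<^sup>2"
  have TS: "T R \<subseteq> S R" unfolding S_def T_def by (rule annulus_mono) auto
  have QT: "?Q \<subseteq> T R" unfolding T_def by (rule square_annulus_subset_annulus[OF \<open>0 < R\<close>])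
  have Q\<Omega>: "?Q \<subseteq> \<Omega>" and T\<Omega>: "T R \<subseteq> \<Omega>" using QT TS sub by blast+
  have cS: "compact (S R)" and cT: "compact (T R)"
    unfolding S_def T_def by (rule compact_annulus[OF \<open>0 < R\<close>])+
  have cQ: "compact ?Q" by (rule compact_square_annulus)
  note w = C1_on_abs_powr[OF u \<open>2 \<le> q\<close>]
  have w_cont: "continuous_on X ?w" if "X \<subseteq> \<Omega>" for X
    by (rule continuous_on_subset[OF C1_onD(3)[OF w(1)] that])
  have dw_cont: "continuous_on ?Q (partial_deriv j ?w)" for j
    by (rule continuous_on_subset[OF C1_onD(2)[OF w(1)] Q\<Omega>])
  note d_cont = continuous_on_weighted_gradient[OF u _ \<open>2 \<le> q\<close>]
  have d_nn: "0 \<le> ?d x" for x using power_weight_nonneg by (intro mult_nonneg_nonneg) auto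
  have pointwise: "?w x / R + (\<Sum>j\<in>UNIV. \<bar>partial_deriv j ?w x\<bar>)
      \<le> (1 / R + q * \<mu>) * ?w x + q / \<mu> * ?d x" if "x \<in> ?Q" for x
  proof -
    let ?m = "power_weight q (u x)"
    have "x \<in> \<Omega>" using that Q\<Omega> by blast
    have each: "\<bar>partial_deriv j ?w x\<bar> \<le> q * (\<mu> * ?w x / 2 + ?m * (partial_deriv j u x)\<^sup>2 / \<mu>)" for j
    proof -
      let ?D = "partial_deriv j u x"
      have "0 \<le> (\<mu> * \<bar>u x\<bar> - \<bar>?D\<bar>)\<^sup>2" by simp
      then have "2 * \<mu> * (\<bar>u x\<bar> * \<bar>?D\<bar>) \<le> \<mu>\<^sup>2 * (u x)\<^sup>2 + ?D\<^sup>2"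
        by (simp add: power2_diff power_mult_distrib algebra_simps)
      moreover have "0 \<le> ?D\<^sup>2" by simp
      ultimately have "2 * \<mu> * (\<bar>u x\<bar> * \<bar>?D\<bar>) \<le> \<mu>\<^sup>2 * (u x)\<^sup>2 + 2 * ?D\<^sup>2" by linarith
      then have "\<bar>u x\<bar> * \<bar>?D\<bar> \<le> \<mu> * (u x)\<^sup>2 / 2 + ?D\<^sup>2 / \<mu>"
        using \<open>0 < \<mu>\<close> by (simp add: field_simps power2_eq_square)
      then have "(q * ?m) * (\<bar>u x\<bar> * \<bar>?D\<bar>) \<le> (q * ?m) * (\<mu> * (u x)\<^sup>2 / 2 + ?D\<^sup>2 / \<mu>)"
        using \<open>2 \<le> q\<close> power_weight_nonneg by (intro mult_left_mono mult_nonneg_nonneg) auto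
      moreover have "\<bar>partial_deriv j ?w x\<bar> = (q * ?m) * (\<bar>u x\<bar> * \<bar>?D\<bar>)"
        using \<open>2 \<le> q\<close> power_weight_nonneg[of q "u x"]
        by (simp add: w(2)[OF \<open>x \<in> \<Omega>\<close>] abs_mult)
      ultimately show ?thesis
        by (simp add: powr_eq_power_weight[OF \<open>2 \<le> q\<close>] algebra_simps)
    qed
    have "(\<Sum>j\<in>UNIV. \<bar>partial_deriv j ?w x\<bar>) \<le> q * (\<mu> * ?w x) + q / \<mu> * ?d x"
      using each[of 1] each[of 2] unfolding norm_gradient_sq sum_2 by (simp add: algebra_simps)
    then show ?thesis by (simp add: algebra_simps)
  qed
  have int: "integrable lborel (\<lambda>x. indicator ?Q x *\<^sub>R f x)" if "continuous_on ?Q f" for f :: "real^2 \<Rightarrow> real"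
    by (rule borel_integrable_compact[OF cQ that])
  have "(LINT x:?Q|lborel. ?w x / R + (\<Sum>j\<in>UNIV. \<bar>partial_deriv j ?w x\<bar>))
      \<le> (LINT x:?Q|lborel. (1 / R + q * \<mu>) * ?w x + q / \<mu> * ?d x)"
    unfolding set_lebesgue_integral_def
  proof (rule integral_mono)
    show "integrable lborel (\<lambda>x. indicator ?Q x *\<^sub>R (?w x / R + (\<Sum>j\<in>UNIV. \<bar>partial_deriv j ?w x\<bar>)))"
      by (intro int continuous_intros w_cont[OF Q\<Omega>] dw_cont) (use \<open>0 < R\<close> in auto)
    show "integrable lborel (\<lambda>x. indicator ?Q x *\<^sub>R ((1 / R + q * \<mu>) * ?w x + q / \<mu> * ?d x))"
      by (intro int continuous_on_add continuous_on_mult continuous_on_const w_cont[OF Q\<Omega>] d_cont[OF Q\<Omega>])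
  qed (use pointwise in \<open>auto simp: indicator_def\<close>)
  also have "\<dots> = (1 / R + q * \<mu>) * (LINT x:?Q|lborel. ?w x) + q / \<mu> * (LINT x:?Q|lborel. ?d x)"
    using int[OF w_cont[OF Q\<Omega>]] int[OF d_cont[OF Q\<Omega>]]
    by (subst set_integral_add) (simp_all add: set_integrable_def mult.left_commute)
  also have "\<dots> \<le> (1 / R + q * \<mu>) * (LINT x:S R|lborel. ?w x) + q / \<mu> * E"
  proof (intro add_mono mult_left_mono)
    show "(LINT x:?Q|lborel. ?w x) \<le> (LINT x:S R|lborel. ?w x)"
      using QT TS by (intro set_integral_mono_subset cS cQ w_cont sub) auto
    have "(LINT x:?Q|lborel. ?d x) \<le> (LINT x:T R|lborel. ?d x)"
      by (intro set_integral_mono_subset cT cQ d_cont T\<Omega> QT d_nn)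
    with energy show "(LINT x:?Q|lborel. ?d x) \<le> E" by linarith
  qed (use \<open>0 < R\<close> \<open>0 < \<mu>\<close> \<open>2 \<le> q\<close> in auto)
  finally have le: "4 / R * (LINT x:?Q|lborel. ?w x / R + (\<Sum>j\<in>UNIV. \<bar>partial_deriv j ?w x\<bar>))
      \<le> 4 / R * ((1 / R + q * \<mu>) * (LINT x:S R|lborel. ?w x) + q / \<mu> * E)"
    using \<open>0 < R\<close> by (intro mult_left_mono) auto
  have "\<exists>s\<in>{R..2*R}. \<forall>x. infnorm x = s \<longrightarrow>
      ?w x \<le> 4 / R * (LINT x:?Q|lborel. ?w x / R + (\<Sum>j\<in>UNIV. \<bar>partial_deriv j ?w x\<bar>))"
    by (rule exists_square_with_small_values[OF \<open>0 < R\<close> w(1) Q\<Omega>]) simp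
  then show ?thesis using le by (meson order_trans)
qed

text \<open>
  Every point leaves the annulus eventually, so dominated convergence applies, with \<open>|u|\<^sup>q\<close> on \<open>\<Omega>\<close> as
  the dominating function.
\<close>

lemma tendsto_integral_annulus_0:
  assumes u: "in_Lq q \<Omega> u" and "open \<Omega>" and sub: "\<forall>\<^sub>F R in at_top. annulus \<rho> \<sigma> R \<subseteq> \<Omega>" and "0 < \<rho>"
    and cont: "continuous_on \<Omega> (\<lambda>x. \<bar>u x\<bar> powr q)"
  shows "((\<lambda>R. LINT x:annulus \<rho> \<sigma> R|lborel. \<bar>u x\<bar> powr q) \<longlongrightarrow> 0) at_top"
proof -
  define f where "f = (\<lambda>x. indicator \<Omega> x *\<^sub>R \<bar>u x\<bar> powr q)"
  have "\<Omega> \<in> sets lebesgue" using \<open>open \<Omega>\<close> by auto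
  then have f: "integrable lebesgue f"
    using u unfolding in_Lq_def f_def by (simp add: integrable_restrict_space)
  have "((\<lambda>R. \<integral>x. indicator (annulus \<rho> \<sigma> R) x *\<^sub>R f x \<partial>lebesgue) \<longlongrightarrow> (\<integral>x. 0 \<partial>(lebesgue :: (real^2) measure))) at_top"
  proof (rule integral_dominated_convergence_at_top[where w = f])
    show "(\<lambda>x. indicator (annulus \<rho> \<sigma> R) x *\<^sub>R f x) \<in> borel_measurable lebesgue" for R
    proof -
      have "closed (annulus \<rho> \<sigma> R)"
        unfolding annulus_def divide_inverse
        by (intro closed_Collect_conj closed_Collect_le continuous_intros)
      then have "annulus \<rho> \<sigma> R \<in> sets lebesgue" by auto
      with f show ?thesis by (intro borel_measurable_scaleR borel_measurable_indicator) auto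
    qed
    show "\<forall>\<^sub>F R in at_top. AE x in lebesgue. norm (indicator (annulus \<rho> \<sigma> R) x *\<^sub>R f x) \<le> f x"
      by (intro always_eventually allI AE_I2) (auto simp: f_def indicator_def)
    have "((\<lambda>R. indicator (annulus \<rho> \<sigma> R) x *\<^sub>R f x) \<longlongrightarrow> 0) at_top" for x
    proof (rule tendsto_eventually)
      have "\<forall>\<^sub>F R in at_top. x \<bullet> x / R\<^sup>2 < \<rho>"
      proof (rule order_tendstoD(2)[OF _ \<open>0 < \<rho>\<close>])
        show "((\<lambda>R. x \<bullet> x / R\<^sup>2) \<longlongrightarrow> 0) at_top"
          by (intro tendsto_divide_0[OF tendsto_const] filterlim_at_top_imp_at_infinity
              filterlim_pow_at_top filterlim_ident) simp
      qed
      then show "\<forall>\<^sub>F R in at_top. indicator (annulus \<rho> \<sigma> R) x *\<^sub>R f x = 0"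
        by eventually_elim (auto simp: annulus_def)
    qed
    then show "AE x in lebesgue. ((\<lambda>R. indicator (annulus \<rho> \<sigma> R) x *\<^sub>R f x) \<longlongrightarrow> 0) at_top"
      by (intro AE_I2)
  qed (use f in auto)
  moreover have "\<forall>\<^sub>F R in at_top. (\<integral>x. indicator (annulus \<rho> \<sigma> R) x *\<^sub>R f x \<partial>lebesgue)
      = (LINT x:annulus \<rho> \<sigma> R|lborel. \<bar>u x\<bar> powr q)"
    using sub eventually_gt_at_top[of 0]
  proof eventually_elim
    case (elim R)
    have eq: "(\<lambda>x. indicator (annulus \<rho> \<sigma> R) x *\<^sub>R f x) = (\<lambda>x. indicator (annulus \<rho> \<sigma> R) x *\<^sub>R \<bar>u x\<bar> powr q)"
      using elim(1) by (auto simp: f_def indicator_def fun_eq_iff)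
    have "(\<lambda>x. indicator (annulus \<rho> \<sigma> R) x *\<^sub>R \<bar>u x\<bar> powr q) \<in> borel_measurable lborel"
      using borel_integrable_compact[OF compact_annulus[OF elim(2)] continuous_on_subset[OF cont elim(1)]] by auto
    then show ?case
      unfolding eq set_lebesgue_integral_def by (rule integral_completion)
  qed
  ultimately show ?thesis by (simp add: tendsto_cong)
qed

section \<open>Decay at infinity\<close>

lemma powr_le_powr_of_comparable:
  fixes t R :: real
  assumes "1 \<le> R" "R / 3 \<le> t" "t \<le> 3 * R" "\<bar>p\<bar> \<le> m" "p \<le> p'"
  shows "t powr p \<le> 3 powr m * R powr p'"
proof -
  have "0 < R" "0 < t" using assms by auto
  define \<tau> where "\<tau> = t / R"
  have \<tau>: "1/3 \<le> \<tau>" "\<tau> \<le> 3" using assms \<open>0 < R\<close> by (auto simp: \<tau>_def field_simps)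
  have "\<tau> powr p \<le> 3 powr \<bar>p\<bar>"
  proof (cases "0 \<le> p")
    case True
    then show ?thesis using \<tau> by (simp add: powr_mono2)
  next
    case False
    then have "\<tau> powr p \<le> (1/3) powr p" using \<tau> by (intro powr_mono2') auto
    also have "\<dots> = 3 powr (- p)" by (simp add: powr_divide powr_minus_divide)
    finally show ?thesis using False by simp
  qed
  also have "\<dots> \<le> 3 powr m" using assms by simp
  finally have "\<tau> powr p \<le> 3 powr m" .
  moreover have "R powr p \<le> R powr p'" using assms by (intro powr_mono) auto
  ultimately have "\<tau> powr p * R powr p \<le> 3 powr m * R powr p'" by (intro mult_mono) auto
  moreover have "t powr p = \<tau> powr p * R powr p"
    using \<open>0 < R\<close> \<open>0 < t\<close> by (simp add: \<tau>_def powr_divide)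
  ultimately show ?thesis by simp
qed

lemma bigo_at_infinityD:
  fixes f g :: "'a::real_normed_vector \<Rightarrow> real"
  assumes "f \<in> O[at_infinity](g)"
  shows "\<exists>C r. 0 < C \<and> (\<forall>x. r \<le> norm x \<longrightarrow> \<bar>f x\<bar> \<le> C * \<bar>g x\<bar>)"
proof -
  obtain C where "0 < C" "\<forall>\<^sub>F x in at_infinity. norm (f x) \<le> C * norm (g x)"
    using landau_o.bigE[OF assms] by blast
  then show ?thesis by (auto simp: eventually_at_infinity)
qed

lemma norm_polar_point: "0 \<le> r \<Longrightarrow> norm (polar_point r \<theta>) = r"
proof -
  assume "0 \<le> r"
  have "(norm (polar_point r \<theta>))\<^sup>2 = (r * cos \<theta>)\<^sup>2 + (r * sin \<theta>)\<^sup>2"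
    unfolding power2_norm_eq_inner inner_vec_def sum_2 polar_point_def by (simp add: power2_eq_square)
  also have "\<dots> = r\<^sup>2 * ((cos \<theta>)\<^sup>2 + (sin \<theta>)\<^sup>2)"
    by (simp only: power_mult_distrib distrib_left)
  finally have "(norm (polar_point r \<theta>))\<^sup>2 = r\<^sup>2" by simp
  then show ?thesis using \<open>0 \<le> r\<close> by (simp add: power2_eq_iff_nonneg)
qed

lemma open_plane_or_exterior: "plane_or_exterior \<Omega> \<Longrightarrow> open \<Omega>"
  unfolding plane_or_exterior_def by (auto intro!: open_Collect_less continuous_intros)

theorem theorem1p1:
  fixes \<Omega> :: "(real^2) set"
    and a :: "2 \<Rightarrow> 2 \<Rightarrow> real^2 \<Rightarrow> real"
    and b :: "real^2 \<Rightarrow> real^2"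
    and c u :: "real^2 \<Rightarrow> real"
    and \<alpha> \<beta> q :: real
  assumes domain: "plane_or_exterior \<Omega>"
    and a_C1: "\<And>i j. C1_on \<Omega> (a i j)"
    and a_sym: "\<And>i j x. x \<in> \<Omega> \<Longrightarrow> a i j x = a j i x"
    and a_elliptic: "\<exists>\<Lambda>>0. \<forall>x\<in>\<Omega>. \<forall>\<xi>::real^2.
          (\<Sum>i\<in>UNIV. \<Sum>j\<in>UNIV. a i j x * \<xi> $ i * \<xi> $ j) \<ge> \<Lambda> * (norm \<xi>)\<^sup>2"
    and \<alpha>_range: "0 \<le> \<alpha>" "\<alpha> \<le> 2"
    and a_growth: "\<And>i j. a i j \<in> O[at_infinity](\<lambda>x. norm x powr \<alpha>)"
    and da_growth: "\<And>i j. partial_deriv i (a i j) \<in> O[at_infinity](\<lambda>x. norm x powr (\<alpha> - 1))"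
    and b_C1: "\<And>i. C1_on \<Omega> (\<lambda>x. b x $ i)"
    and \<beta>_le: "\<beta> \<le> 1"
    and b_growth: "(\<lambda>x. norm (b x)) \<in> O[at_infinity](\<lambda>x. norm x powr \<beta>)"
    and c_measurable: "c \<in> borel_measurable (lebesgue_on \<Omega>)"
    and c_nonneg: "\<And>x. x \<in> \<Omega> \<Longrightarrow> 0 \<le> c x"
    and div_b: "(\<forall>x\<in>\<Omega>. divergence b x \<le> 2 * c x) \<or>
          divergence b \<in> O[at_infinity](\<lambda>x. norm x powr (\<beta> - 1))"
    and u_C2: "C2_on \<Omega> u"
    and pde: "\<And>x. x \<in> \<Omega> \<Longrightarrow>
          - (\<Sum>i\<in>UNIV. \<Sum>j\<in>UNIV. partial_deriv i (\<lambda>y. a i j y * partial_deriv j u y) x)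
            + b x \<bullet> grad u x + c x * u x = 0"
    and q_ge: "2 \<le> q"
    and u_Lq: "in_Lq q \<Omega> u"
  shows "(\<lambda>r. SUP \<theta>\<in>{0..2*pi}. \<bar>u (polar_point r \<theta>)\<bar>)
          \<in> o[at_top](\<lambda>r. r powr (- (1 / q) * (1 + min (1 - \<beta>) (2 - \<alpha>) / 2)))"
proof -
  define \<gamma> where "\<gamma> = min (1 - \<beta>) (2 - \<alpha>)"
  define p where "p = 1 + \<gamma> / 2"
  let ?S = "annulus (1/2) 9" and ?T = "annulus 1 8"
  define I where "I = (\<lambda>R. LINT x:?S R|lborel. \<bar>u x\<bar> powr q)"
  have \<gamma>: "0 \<le> \<gamma>" "\<gamma> \<le> 2" "\<gamma> \<le> 1 - \<beta>" "\<gamma> \<le> 2 - \<alpha>"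
    using \<alpha>_range \<beta>_le by (auto simp: \<gamma>_def)
  obtain l where "0 < l" and ell: "\<And>x v::real^2. x \<in> \<Omega> \<Longrightarrow>
      l * (norm v)\<^sup>2 \<le> (\<Sum>i\<in>UNIV. \<Sum>j\<in>UNIV. a i j x * v $ i * v $ j)"
    using a_elliptic by blast
  have u_C1: "C1_on \<Omega> u" using u_C2 by (simp add: C2_on_def)
  have "open \<Omega>" by (rule open_plane_or_exterior[OF domain])
  obtain r0 where r0: "\<And>x. r0 < norm x \<Longrightarrow> x \<in> \<Omega>"
    using domain unfolding plane_or_exterior_def by blast
  have "(\<lambda>x. \<Sum>i\<in>UNIV. \<Sum>j\<in>UNIV. \<bar>a i j x\<bar>) \<in> O[at_infinity](\<lambda>x. norm x powr \<alpha>)"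
    by (intro big_sum_in_bigo) (simp add: a_growth)
  from bigo_at_infinityD[OF this] obtain C1 r1 where "0 < C1"
    and a_bound: "\<And>x. r1 \<le> norm x \<Longrightarrow>
      \<bar>\<Sum>i\<in>UNIV. \<Sum>j\<in>UNIV. \<bar>a i j x\<bar>\<bar> \<le> C1 * \<bar>norm x powr \<alpha>\<bar>"
    by blast
  have C1: "0 < C1" "\<And>x. r1 \<le> norm x \<Longrightarrow> (\<Sum>i\<in>UNIV. \<Sum>j\<in>UNIV. \<bar>a i j x\<bar>) \<le> C1 * norm x powr \<alpha>"
    using \<open>0 < C1\<close> order_trans[OF abs_ge_self a_bound] by simp_all
  obtain C2 r2 where C2: "0 < C2" "\<And>x. r2 \<le> norm x \<Longrightarrow> norm (b x) \<le> C2 * norm x powr \<beta>"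
    using bigo_at_infinityD[OF b_growth] by auto
  obtain C3 r3 where C3: "0 < C3" "\<And>x. x \<in> \<Omega> \<Longrightarrow> r3 \<le> norm x \<Longrightarrow> divergence b x \<le> 2 * c x + C3 * norm x powr (\<beta> - 1)"
    using div_b
  proof
    assume le: "\<forall>x\<in>\<Omega>. divergence b x \<le> 2 * c x"
    show thesis
    proof (rule that[of 1 0])
      fix x assume "x \<in> \<Omega>"
      then have "divergence b x \<le> 2 * c x" using le by blast
      then show "divergence b x \<le> 2 * c x + 1 * norm x powr (\<beta> - 1)"
        using powr_ge_zero[of "norm x" "\<beta> - 1"] by linarith
    qed simp
  next
    assume "divergence b \<in> O[at_infinity](\<lambda>x. norm x powr (\<beta> - 1))"
    then obtain C r where C: "0 < C" "\<And>x. r \<le> norm x \<Longrightarrow> \<bar>divergence b x\<bar> \<le> C * \<bar>norm x powr (\<beta> - 1)\<bar>"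
      using bigo_at_infinityD by blast
    show thesis
    proof (rule that[of C r])
      fix x assume "x \<in> \<Omega>" "r \<le> norm x"
      then show "divergence b x \<le> 2 * c x + C * norm x powr (\<beta> - 1)"
        using C(2)[of x] c_nonneg[of x] by (simp add: abs_le_iff)
    qed (rule C(1))
  qed
  define m where "m = \<bar>\<alpha>\<bar> + \<bar>\<beta>\<bar> + 1"
  define K where "K = (C1 + C2 + C3) * 3 powr m"
  \<comment> \<open>The factor 2 is there because points of \<open>S\<^sub>R\<close> have norm at least \<open>R / 2\<close>.\<close>
  define R0 where "R0 = 1 + 2 * (\<bar>r0\<bar> + \<bar>r1\<bar> + \<bar>r2\<bar> + \<bar>r3\<bar>)"
  have "0 < K" using C1(1) C2(1) C3(1) by (simp add: K_def)
  have "1 \<le> R0" by (simp add: R0_def)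
  have S\<Omega>: "?S R \<subseteq> \<Omega>" if "R0 \<le> R" for R
  proof
    fix x assume "x \<in> ?S R"
    then have "R / 2 \<le> norm x" using norm_bounds_of_annulus(1)[of R x] that \<open>1 \<le> R0\<close> by simp
    then show "x \<in> \<Omega>" using that by (intro r0) (simp add: R0_def)
  qed
  define C where "C = 4 * (1 + q + q * (52000 * K / l))"
  have "0 < C" using q_ge \<open>0 < K\<close> \<open>0 < l\<close> by (simp add: C_def add_pos_nonneg)
  have I_nonneg: "0 \<le> I R" for R
    unfolding I_def set_lebesgue_integral_def by (rule integral_nonneg_AE) simp
  have square: "\<exists>s\<in>{R..2*R}. \<forall>x. infnorm x = s \<longrightarrow> \<bar>u x\<bar> powr q \<le> C * R powr (- p) * I R" if R: "R0 \<le> R" for R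
  proof -
    have "1 \<le> R" "0 < R" using R \<open>1 \<le> R0\<close> by auto
    define \<mu> where "\<mu> = R powr (- (\<gamma> / 2))"
    have "0 < \<mu>" using \<open>0 < R\<close> by (simp add: \<mu>_def)
    have \<mu>2: "R powr (- \<gamma>) = \<mu> * \<mu>" by (simp add: \<mu>_def flip: powr_add)
    have "R powr (- 1) \<le> \<mu>" unfolding \<mu>_def using \<gamma> \<open>1 \<le> R\<close> by (intro powr_mono) auto
    then have R_\<mu>: "1 / R \<le> \<mu>" using \<open>0 < R\<close> by (simp add: powr_minus_divide)
    have R_p: "1 / R * \<mu> = R powr (- p)"
      using \<open>0 < R\<close> by (simp add: \<mu>_def p_def powr_diff powr_minus_divide)
    have growth: "norm x powr e \<le> 3 powr m * R powr e'"
      if "x \<in> ?S R" "\<bar>e\<bar> \<le> m" "e \<le> e'" for x e e'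
      using norm_bounds_of_annulus[OF \<open>0 < R\<close> that(1)] \<open>0 < R\<close>
      by (intro powr_le_powr_of_comparable[OF \<open>1 \<le> R\<close> _ _ that(2,3)]) auto
    have far: "r1 \<le> norm x" "r2 \<le> norm x" "r3 \<le> norm x" "x \<in> \<Omega>" if "x \<in> ?S R" for x
      using norm_bounds_of_annulus(1)[OF \<open>0 < R\<close> that] R S\<Omega>[OF R] that by (auto simp: R0_def)
    have step: "D * norm x powr e \<le> K * R powr e'"
      if "x \<in> ?S R" "\<bar>e\<bar> \<le> m" "e \<le> e'" "0 < D" "D \<le> C1 + C2 + C3" for x e e' D
    proof -
      have "D * norm x powr e \<le> (C1 + C2 + C3) * (3 powr m * R powr e')"
        using that growth[OF that(1-3)] by (intro mult_mono) auto
      then show ?thesis by (simp add: K_def mult.assoc)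
    qed
    have energy: "l * (LINT x:?T R|lborel. power_weight q (u x) * (norm (grad u x))\<^sup>2)
        \<le> 52000 * (K * R powr (- \<gamma>)) * (LINT x:?S R|lborel. \<bar>u x\<bar> powr q)"
    proof (rule caccioppoli[where \<Omega> = \<Omega> and a = a and b = b and c = c])
      fix x assume x: "x \<in> ?S R"
      show "\<bar>a i j x\<bar> \<le> K * R powr (- \<gamma>) * R\<^sup>2" for i j
      proof -
        have "\<bar>a i j x\<bar> \<le> (\<Sum>j\<in>UNIV. \<bar>a i j x\<bar>)" by (rule member_le_sum) auto
        also have "\<dots> \<le> (\<Sum>i\<in>UNIV. \<Sum>j\<in>UNIV. \<bar>a i j x\<bar>)"
          by (rule member_le_sum[of i UNIV "\<lambda>i. \<Sum>j\<in>UNIV. \<bar>a i j x\<bar>"]) (auto intro: sum_nonneg)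
        also have "\<dots> \<le> C1 * norm x powr \<alpha>" by (rule C1(2)[OF far(1)[OF x]])
        also have "\<dots> \<le> K * R powr (2 - \<gamma>)"
          using C1(1) C2(1) C3(1) \<gamma> by (intro step[OF x]) (auto simp: m_def)
        also have "R powr (2 - \<gamma>) = R powr (- \<gamma>) * R\<^sup>2"
          using \<open>0 < R\<close> by (simp add: powr_diff powr_minus_divide)
        finally show ?thesis by (simp add: mult.assoc)
      qed
      have "norm (b x) \<le> C2 * norm x powr \<beta>" by (rule C2(2)[OF far(2)[OF x]])
      also have "\<dots> \<le> K * R powr (1 - \<gamma>)"
        using C1(1) C2(1) C3(1) \<gamma> by (intro step[OF x]) (auto simp: m_def)
      also have "R powr (1 - \<gamma>) = R powr (- \<gamma>) * R"
        using \<open>0 < R\<close> by (simp add: powr_diff powr_minus_divide)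
      finally show "norm (b x) \<le> K * R powr (- \<gamma>) * R" by (simp add: mult.assoc)
      have "C3 * norm x powr (\<beta> - 1) \<le> K * R powr (- \<gamma>)"
        using C1(1) C2(1) C3(1) \<gamma> by (intro step[OF x]) (auto simp: m_def)
      then show "divergence b x \<le> 2 * c x + K * R powr (- \<gamma>)"
        using C3(2)[OF far(4)[OF x] far(3)[OF x]] by linarith
    qed (use \<open>open \<Omega>\<close> a_C1 b_C1 u_C2 a_sym \<open>0 < l\<close> ell c_nonneg pde q_ge \<open>0 < R\<close> S\<Omega>[OF R] in auto)
    define E where "E = 52000 * K / l * (\<mu> * \<mu>) * I R"
    have "(LINT x:?T R|lborel. power_weight q (u x) * (norm (grad u x))\<^sup>2) \<le> E"
      using energy \<open>0 < l\<close> unfolding E_def I_def \<mu>2 by (simp add: field_simps)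
    from exists_square_power_bound[OF u_C1 q_ge \<open>0 < R\<close> S\<Omega>[OF R] \<open>0 < \<mu>\<close> this]
    obtain s where s: "s \<in> {R..2*R}"
      "\<And>x. infnorm x = s \<Longrightarrow> \<bar>u x\<bar> powr q \<le> 4 / R * ((1 / R + q * \<mu>) * I R + q / \<mu> * E)"
      unfolding I_def by blast
    have "(1 / R + q * \<mu>) * I R \<le> (\<mu> + q * \<mu>) * I R"
      by (rule mult_right_mono) (use R_\<mu> I_nonneg in auto)
    then have "4 / R * ((1 / R + q * \<mu>) * I R + q / \<mu> * E) \<le> 4 / R * ((\<mu> + q * \<mu>) * I R + q / \<mu> * E)"
      using \<open>0 < R\<close> by (intro mult_left_mono) auto
    also have "\<dots> = C * (1 / R * \<mu>) * I R"
      using \<open>0 < \<mu>\<close> \<open>0 < R\<close> \<open>0 < l\<close> by (simp add: C_def E_def field_simps)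
    finally show ?thesis using s unfolding R_p by (meson order_trans)
  qed
  have I_lim: "(I \<longlongrightarrow> 0) at_top"
    unfolding I_def
  proof (rule tendsto_integral_annulus_0[OF u_Lq \<open>open \<Omega>\<close>])
    show "\<forall>\<^sub>F R in at_top. ?S R \<subseteq> \<Omega>"
      using eventually_ge_at_top[of R0] by eventually_elim (rule S\<Omega>)
    show "continuous_on \<Omega> (\<lambda>x. \<bar>u x\<bar> powr q)"
      by (rule C1_onD(3)[OF C1_on_abs_powr(1)[OF u_C1 q_ge]])
  qed simp
  have circle: "\<forall>\<^sub>F r in at_top. \<forall>x. norm x = r \<longrightarrow> \<bar>u x\<bar> \<le> \<epsilon> * r powr (- (1 / q) * p)" if "0 < \<epsilon>" for \<epsilon>
  proof -
    \<comment> \<open>The factor \<open>4 powr p\<close> pays for using the radius \<open>r / 4\<close> on the inner square.\<close>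
    define \<eta> where "\<eta> = \<epsilon> powr q / (C * 4 powr p)"
    have "C * 4 powr p \<noteq> 0" using \<open>0 < C\<close> by simp
    have "0 < \<eta>" using \<open>0 < \<epsilon>\<close> \<open>0 < C\<close> by (simp add: \<eta>_def)
    have "\<forall>\<^sub>F r in at_top. I r < \<eta>" by (rule order_tendstoD(2)[OF I_lim \<open>0 < \<eta>\<close>])
    then obtain N where N: "\<And>r. N \<le> r \<Longrightarrow> I r < \<eta>"
      unfolding eventually_at_top_linorder by blast
    show ?thesis
      using eventually_ge_at_top[of "4 * R0"] eventually_ge_at_top[of "4 * N"]
    proof eventually_elim
      case (elim r)
      have r: "0 < r" "R0 \<le> r / 4" "N \<le> r / 4" "R0 \<le> r" "N \<le> r"
        using elim \<open>1 \<le> R0\<close> by simp_all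
      define M where "M = \<epsilon> * r powr (- (1 / q) * p)"
      have "0 \<le> M" using \<open>0 < \<epsilon>\<close> by (simp add: M_def)
      have Mq: "M powr q = \<epsilon> powr q * r powr (- p)"
      proof -
        have "- (1 / q) * p * q = - p" using q_ge by simp
        then show ?thesis
          unfolding M_def using \<open>0 < \<epsilon>\<close> by (simp only: powr_mult powr_powr less_imp_le powr_ge_zero)
      qed
      have small: "\<exists>s\<in>{R..2*R}. \<forall>x. infnorm x = s \<longrightarrow> \<bar>u x\<bar> \<le> M" if R: "r / 4 \<le> R" for R
      proof -
        have "R0 \<le> R" "N \<le> R" using r(2,3) R by simp_all
        from square[OF this(1)] obtain s where s: "s \<in> {R..2*R}"
          "\<And>x. infnorm x = s \<Longrightarrow> \<bar>u x\<bar> powr q \<le> C * R powr (- p) * I R"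
          by blast
        have "0 < r / 4" "- p \<le> 0" using r(1) \<gamma>(1) by (simp_all add: p_def)
        then have "R powr (- p) \<le> (r / 4) powr (- p)" by (intro powr_mono2' R)
        then have "C * R powr (- p) \<le> C * (r / 4) powr (- p)"
          by (rule mult_left_mono) (rule less_imp_le[OF \<open>0 < C\<close>])
        moreover have "0 \<le> C * (r / 4) powr (- p)"
          using \<open>0 < C\<close> by simp
        ultimately have "C * R powr (- p) * I R \<le> C * (r / 4) powr (- p) * \<eta>"
          by (rule mult_mono[OF _ less_imp_le[OF N[OF \<open>N \<le> R\<close>]] _ I_nonneg])
        also have "(r / 4) powr (- p) = 4 powr p * r powr (- p)"
          using r(1) powr_divide[of r 4 "- p"] by (simp add: powr_minus_divide)
        also have "C * (4 powr p * r powr (- p)) * \<eta> = (C * 4 powr p) * \<eta> * r powr (- p)"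
          by (simp only: mult_ac)
        also have "(C * 4 powr p) * \<eta> = \<epsilon> powr q"
          unfolding \<eta>_def times_divide_eq_right by (rule nonzero_mult_div_cancel_left) fact
        also note Mq[symmetric]
        finally have le: "C * R powr (- p) * I R \<le> M powr q" .
        have "\<bar>u x\<bar> \<le> M" if "infnorm x = s" for x
        proof (rule ccontr)
          assume "\<not> \<bar>u x\<bar> \<le> M"
          then have "M powr q < \<bar>u x\<bar> powr q" using \<open>0 \<le> M\<close> q_ge by (intro powr_less_mono2) auto
          with s(2)[OF that] le show False by linarith
        qed
        with s(1) show ?thesis by blast
      qed
      obtain s1 where s1: "s1 \<in> {r/4..2*(r/4)}" "\<And>x. infnorm x = s1 \<Longrightarrow> \<bar>u x\<bar> \<le> M"
        using small[OF order_refl] by blast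
      obtain s2 where s2: "s2 \<in> {r..2*r}" "\<And>x. infnorm x = s2 \<Longrightarrow> \<bar>u x\<bar> \<le> M"
      proof -
        have "r / 4 \<le> r" using r(1) by simp
        from small[OF this] show thesis using that by blast
      qed
      define U where "U = {x::real^2. s1 < infnorm x \<and> infnorm x < s2}"
      let ?Q = "{x::real^2. s1 \<le> infnorm x \<and> infnorm x \<le> s2}"
      have "open U" unfolding U_def by (intro open_Collect_conj open_Collect_less continuous_intros)
      have clU: "closure U \<subseteq> ?Q"
        by (rule closure_minimal) (auto simp: U_def intro: compact_imp_closed compact_square_annulus)
      have "bounded U"
        by (rule bounded_subset[OF compact_imp_bounded[OF compact_square_annulus[of s1 s2]]]) (auto simp: U_def)
      have Q\<Omega>: "x \<in> \<Omega>" if "x \<in> ?Q" for x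
      proof (rule r0)
        have "r / 4 \<le> norm x" using that s1(1) infnorm_le_norm[of x] by auto
        then show "r0 < norm x" using r(2) by (simp add: R0_def)
      qed
      show ?case
      proof (intro allI impI)
        fix x :: "real^2" assume x: "norm x = r"
        have "infnorm x \<le> s2" using infnorm_le_norm[of x] x s2(1) by simp
        \<comment> \<open>The circle stays outside the inner square as \<open>s1 \<le> r / 2 < r / \<surd>2\<close>.\<close>
        have "s1 < infnorm x"
        proof -
          have "r \<le> sqrt 2 * infnorm x" using norm_le_infnorm[of x] x by simp
          moreover have "sqrt 2 * infnorm x < 2 * infnorm x"
          proof (rule mult_strict_right_mono)
            show "sqrt 2 < (2::real)" by (rule real_less_lsqrt) simp_all
            have "x \<noteq> 0" using x r(1) by force
            then show "0 < infnorm x" by (simp add: infnorm_pos_lt)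
          qed
          ultimately have "r < 2 * infnorm x" by linarith
          with s1(1) show ?thesis by simp
        qed
        show "\<bar>u x\<bar> \<le> \<epsilon> * r powr (- (1 / q) * p)"
          unfolding M_def[symmetric]
        proof (cases "infnorm x = s2")
          case True
          then show "\<bar>u x\<bar> \<le> M" by (rule s2(2))
        next
          case False
          with \<open>infnorm x \<le> s2\<close> \<open>s1 < infnorm x\<close> have "x \<in> U" by (simp add: U_def)
          show "\<bar>u x\<bar> \<le> M"
          proof (rule abs_le_of_frontier[where \<Omega> = \<Omega> and a = a and b = b and c = c and U = U])
            show "closure U \<subseteq> \<Omega>" using clU Q\<Omega> by blast
            fix y assume "y \<in> frontier U"
            then have "y \<in> ?Q" "y \<notin> U"
              using clU \<open>open U\<close> by (auto simp: frontier_def interior_open)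
            then have "infnorm y = s1 \<or> infnorm y = s2" by (auto simp: U_def)
            then show "\<bar>u y\<bar> \<le> M" using s1(2) s2(2) by blast
          qed (rule a_C1 b_C1 u_C2 a_sym \<open>0 < l\<close> ell c_nonneg pde \<open>open U\<close> \<open>bounded U\<close> \<open>0 \<le> M\<close> \<open>x \<in> U\<close> | assumption)+
        qed
      qed
    qed
  qed
  show ?thesis
  proof (rule landau_o.smallI)
    fix \<epsilon> :: real assume "0 < \<epsilon>"
    from circle[OF this] eventually_ge_at_top[of 0]
    show "\<forall>\<^sub>F r in at_top. norm (SUP \<theta>\<in>{0..2*pi}. \<bar>u (polar_point r \<theta>)\<bar>)
        \<le> \<epsilon> * norm (r powr (- (1 / q) * (1 + min (1 - \<beta>) (2 - \<alpha>) / 2)))"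
    proof eventually_elim
      case (elim r)
      let ?B = "\<epsilon> * r powr (- (1 / q) * p)"
      have le: "\<bar>u (polar_point r \<theta>)\<bar> \<le> ?B" for \<theta>
        using elim norm_polar_point by blast
      have "(SUP \<theta>\<in>{0..2*pi}. \<bar>u (polar_point r \<theta>)\<bar>) \<le> ?B"
        by (rule cSUP_least[OF _ le]) simp
      moreover have "\<bar>u (polar_point r 0)\<bar> \<le> (SUP \<theta>\<in>{0..2*pi}. \<bar>u (polar_point r \<theta>)\<bar>)"
        by (rule cSUP_upper[OF _ bdd_aboveI2[OF le]]) simp
      ultimately show ?case by (simp add: p_def \<gamma>_def)
    qed
  qed
qed

end
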